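(* Assume that the supremum in the dual problem $$\sup_{\Phi}\; -\mathcal F^{h,\star}(-\Phi)-h\,\mathbb E_{\overline{\mathbb P}^h}\Big[\exp\Big(\frac{\Delta\Phi}{h}\Big)\Big]$$ is attained at some $\Phi=(\{\phi_{\nu_k}\},\{\phi_{m_k}\},\{\Lambda_k\})\in E$. Then $\Phi$ induces a measure $\mathbb P^h$ on $\Omega^h$ through $$\frac{d\mathbb P^h}{d\overline{\mathbb P}^h}=\exp\Big(\frac{\Delta\Phi}{h}\Big),$$ and, provided the constraint functions $M_0$ and $C_k$ ($0\le k\le N_T-1$) are finite under $\mathbb P^h$ (i.e. $M_0$ is finite at the time-$0$ marginal of $\mathbb P^h$, and each $C_k$ is finite at the vector $g_k$ associated with $\mathbb P^h$), $\mathbb P^h$ is the optimal solution of the primal problem $$\inf_{\mathbb P\in\mathcal P(\Omega^h)}\ \mathcal F^h(\Delta^\dagger\mathbb P)+h\,\mathrm{KL}(\mathbb P\,|\,\overline{\mathbb P}^h).$$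
   Context: Let $h>0$, let $N_T,K\ge1$ be integers, $t_k=kh$, let $\mathcal X_k\subseteq\mathbb R$ ($0\le k\le N_T$) be Borel sets and $\Omega^h=\prod_{k=0}^{N_T}\mathcal X_k$ with canonical process $(X_k)$; $\mathcal P(\Omega^h)$ is the set of probability measures on $\Omega^h$. The reference measure $\overline{\mathbb P}^h\in\mathcal P(\Omega^h)$ is the law of the Euler–Maruyama chain $Y_{k+1}=Y_k+\overline\mu(Y_k,kh)h+\overline\sigma(Y_k,kh)h^{1/2}Z_k$, with $Z_k$ i.i.d. standard normal and $Y_0\sim\rho_0$ (the chain being assumed to take values in $\Omega^h$). For $\mathbb P\ll\overline{\mathbb P}^h$, $\mathrm{KL}(\mathbb P|\overline{\mathbb P}^h)=\mathbb E_{\mathbb P}[\log\frac{d\mathbb P}{d\overline{\mathbb P}^h}-1]$, and $\mathrm{KL}=+\infty$ otherwise. Data: $B:\mathbb R\times\mathbb R\to\mathbb R^K$; for each $k=0,\dots,N_T-1$ a finite (possibly empty) index set $\mathcal I_k$ of price constraints at time $t_k$ and payoff functions $G_i$, $i\in\mathcal I_k$, where $B$ is bounded continuous on $\mathcal X_k\times\mathcal X_{k+1}$ and $G_i$ is bounded continuous on $\mathcal X_k$; convex functions $C_k:\mathbb R^{\#\mathcal I_k}\to(-\infty,+\infty]$ (with $C_k=0$ if $\mathcal I_k=\emptyset$); a proper, convex, lower semicontinuous $F:\mathbb R^K\to(-\infty,+\infty]$; a probability measure $\nu_0^{\rm init}$ on $\mathcal X_0$ (imposed initial law) and $M_0(\nu)=0$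 if $\nu=\nu_0^{\rm init}$, $+\infty$ otherwise. Let $E=\prod_{k=0}^{N_T-1}C_b(\mathcal X_k)\times\prod_{k=0}^{N_T-1}C_b(\mathcal X_k;\mathbb R^K)\times\prod_{k=0}^{N_T-1}\mathbb R^{\#\mathcal I_k}$ ($C_b$: bounded continuous functions), put in duality with $E^*=\prod_k\mathcal M(\mathcal X_k)\times\prod_k\mathcal M(\mathcal X_k;\mathbb R^K)\times\prod_k\mathbb R^{\#\mathcal I_k}$ (finite signed, resp. $\mathbb R^K$-valued, Borel measures) by integration and the Euclidean scalar product. For $\Phi=(\{\phi_{\nu_k}\},\{\phi_{m_k}\},\{\Lambda_k\})\in E$ define $\Delta\Phi\in C_b(\Omega^h)$ by $$\Delta\Phi(x_0,\dots,x_{N_T})=\sum_{k=0}^{N_T-1}\Big(h\,\phi_{\nu_k}(x_k)+\phi_{m_k}(x_k)\cdot B(x_k,x_{k+1})+\Lambda_k\cdot\{G_i(x_k)\}_{i\in\mathcal I_k}\Big).$$ Its adjoint is $\Delta^\dagger\mathbb P=(\{h\nu_k\},\{h m_k\},\{g_k\})$ where $\nu_k$ is the law of $X_k$ under $\mathbb P$, $m_k(dx)=\nu_k(dx)\,\frac1h\mathbb E_{\mathbb P}[B(X_k,X_{k+1})|X_k=x]$ and $g_k=\{\mathbb E_{\mathbb P}[G_i(X_k)]\}_{i\in\mathcal I_k}$. The function $\mathcal F^h:E^*\to(-\infty,+\infty]$ is $$\mathcal F^h(\{h\nu_k\},\{hm_k\},\{g_k\})=\sum_{k=0}^{N_T-1}\Big(h\int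 F\Big(\frac{dm_k}{d\nu_k}\Big)d\nu_k+C_k(g_k)\Big)+M_0(\nu_0)$$ if all $\nu_k\ge0$ and $m_k\ll\nu_k$, and $+\infty$ otherwise. It is assumed proper, convex and lower semicontinuous for the weak topology of the pairing $(E,E^* )$. $\mathcal F^{h,\star}(\Phi)=\sup_{\xi\in E^*}\langle\Phi,\xi\rangle-\mathcal F^h(\xi)$ is its Legendre–Fenchel transform. *)

theory Defs
  imports "HOL-Probability.Probability"
begin

section \<open>Extended-real valued convex analysis\<close>

text \<open>Integral of an extended-real valued function. It is the usual one whenever the
  negative (or the positive) part has finite integral, which is the case in all uses below.\<close>

definition ext_integral :: "'a measure \<Rightarrow> ('a \<Rightarrow> ereal) \<Rightarrow> ereal" where
  "ext_integral M f =
     enn2ereal (\<integral>\<^sup>+ x. e2ennreal (f x) \<partial>M) - enn2ereal (\<integral>\<^sup>+ x. e2ennreal (- f x) \<partial>M)"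

definition proper_on :: "'a set \<Rightarrow> ('a \<Rightarrow> ereal) \<Rightarrow> bool" where
  "proper_on S f \<longleftrightarrow> (\<forall>x\<in>S. f x \<noteq> - \<infinity>) \<and> (\<exists>x\<in>S. f x \<noteq> \<infinity>)"

text \<open>The convex combination \<open>comb t x y\<close>, that is \<open>t x + (1 - t) y\<close>, is a parameter because
  some of the vector spaces below are spaces of functions, which are not instances of the
  class of real vector spaces.\<close>

definition convex_ext_on ::
  "(real \<Rightarrow> 'a \<Rightarrow> 'a \<Rightarrow> 'a) \<Rightarrow> 'a set \<Rightarrow> ('a \<Rightarrow> ereal) \<Rightarrow> bool" where
  "convex_ext_on comb S f \<longleftrightarrow>
     (\<forall>x\<in>S. \<forall>y\<in>S. \<forall>t. 0 < t \<and> t < 1 \<longrightarrow>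
        f (comb t x y) \<le> ereal t * f x + ereal (1 - t) * f y)"

definition lsc_in :: "'a topology \<Rightarrow> ('a \<Rightarrow> ereal) \<Rightarrow> bool" where
  "lsc_in T f \<longleftrightarrow> (\<forall>c. openin T {x \<in> topspace T. c < f x})"

text \<open>\<open>\<real>\<^bsup>J\<^esup>\<close> is the set \<open>J \<rightarrow>\<^sub>E UNIV\<close> of extensional functions.\<close>

definition fun_comb ::
  "'i set \<Rightarrow> real \<Rightarrow> ('i \<Rightarrow> real) \<Rightarrow> ('i \<Rightarrow> real) \<Rightarrow> 'i \<Rightarrow> real" where
  "fun_comb J t x y = (\<lambda>i\<in>J. t * x i + (1 - t) * y i)"


section \<open>Signed and vector-valued measures\<close>

text \<open>A finite signed (\<open>'b = real\<close>) or vector-valued measure on the measurable space \<open>S\<close>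
  (only \<open>space S\<close> and \<open>sets S\<close> matter) is a countably additive set function; its values
  outside \<open>sets S\<close> are irrelevant.\<close>

definition vector_measure :: "'a measure \<Rightarrow> ('a set \<Rightarrow> 'b::real_normed_vector) \<Rightarrow> bool" where
  "vector_measure S \<mu> \<longleftrightarrow>
     (\<forall>A::nat \<Rightarrow> 'a set. range A \<subseteq> sets S \<longrightarrow> disjoint_family A \<longrightarrow>
        (\<lambda>n. \<mu> (A n)) sums \<mu> (\<Union>n. A n))"

text \<open>The positive part of the Jordan decomposition. Since \<open>ennreal\<close> sends negative reals
  to 0, for a nonnegative \<open>\<mu>\<close> this is \<open>\<mu>\<close> itself as an element of \<^typ>\<open>'a measure\<close>.\<close>

definition jordan_pos :: "'a measure \<Rightarrow> ('a set \<Rightarrow> real) \<Rightarrow> 'a measure" where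
  "jordan_pos S \<mu> =
     measure_of (space S) (sets S) (\<lambda>A. SUP D\<in>{D \<in> sets S. D \<subseteq> A}. ennreal (\<mu> D))"

definition signed_integral :: "'a measure \<Rightarrow> ('a set \<Rightarrow> real) \<Rightarrow> ('a \<Rightarrow> real) \<Rightarrow> real" where
  "signed_integral S \<mu> f =
     (\<integral>x. f x \<partial>jordan_pos S \<mu>) - (\<integral>x. f x \<partial>jordan_pos S (\<lambda>A. - \<mu> A))"

definition vector_integral ::
  "'a measure \<Rightarrow> ('a set \<Rightarrow> real ^ 'k) \<Rightarrow> ('a \<Rightarrow> real ^ 'k) \<Rightarrow> real" where
  "vector_integral S m f = (\<Sum>j\<in>UNIV. signed_integral S (\<lambda>A. m A $ j) (\<lambda>x. f x $ j))"

text \<open>The Radon-Nikodym derivative \<open>dm/d\<nu>\<close>, unique up to \<open>\<nu>\<close>-null sets.\<close>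

definition vector_RN_deriv ::
  "'a measure \<Rightarrow> ('a set \<Rightarrow> real ^ 'k) \<Rightarrow> 'a \<Rightarrow> real ^ 'k" where
  "vector_RN_deriv \<nu> m =
     (SOME f. f \<in> borel_measurable \<nu> \<and> integrable \<nu> f \<and>
        (\<forall>A\<in>sets \<nu>. m A = (LINT x:A|\<nu>. f x)))"

text \<open>\<open>x \<mapsto> E\<^sub>P[f | X = x]\<close> for a random variable \<open>X\<close> with values in \<open>S\<close>: the density of
  \<open>A \<mapsto> E\<^sub>P[f; X \<in> A]\<close> with respect to the law of \<open>X\<close>.\<close>

definition cond_exp_given ::
  "'w measure \<Rightarrow> 'a measure \<Rightarrow> ('w \<Rightarrow> 'a) \<Rightarrow> ('w \<Rightarrow> real ^ 'k) \<Rightarrow> 'a \<Rightarrow> real ^ 'k" where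
  "cond_exp_given P S X f =
     vector_RN_deriv (distr P S X) (\<lambda>A. LINT \<omega>:(X -` A \<inter> space P)|P. f \<omega>)"


section \<open>Path space and reference measure\<close>

definition state_space :: "(nat \<Rightarrow> real set) \<Rightarrow> nat \<Rightarrow> real measure" where
  "state_space X k = restrict_space borel (X k)"

definition path_space :: "nat \<Rightarrow> (nat \<Rightarrow> real set) \<Rightarrow> (nat \<Rightarrow> real) measure" where
  "path_space N X = restrict_space (\<Pi>\<^sub>M k\<in>{..N}. borel) (\<Pi>\<^sub>E k\<in>{..N}. X k)"

primrec euler_chain ::
  "real \<Rightarrow> (real \<Rightarrow> real \<Rightarrow> real) \<Rightarrow> (real \<Rightarrow> real \<Rightarrow> real) \<Rightarrow> real \<Rightarrow> (nat \<Rightarrow> real) \<Rightarrow> nat \<Rightarrow> real"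
where
  "euler_chain h \<mu> \<sigma> y z 0 = y"
| "euler_chain h \<mu> \<sigma> y z (Suc k) =
     (let x = euler_chain h \<mu> \<sigma> y z k
      in x + \<mu> x (real k * h) * h + \<sigma> x (real k * h) * sqrt h * z k)"

text \<open>The joint law of the initial value \<open>Y\<^sub>0 \<sim> \<rho>\<^sub>0\<close> and of the independent standard normal
  increments \<open>Z\<^sub>0, \<dots>, Z\<^bsub>N-1\<^esub>\<close>.\<close>

definition noise_law :: "nat \<Rightarrow> real measure \<Rightarrow> (real \<times> (nat \<Rightarrow> real)) measure" where
  "noise_law N \<rho>\<^sub>0 = \<rho>\<^sub>0 \<Otimes>\<^sub>M (\<Pi>\<^sub>M k\<in>{..<N}. density lborel (\<lambda>x. ennreal (std_normal_density x)))"

definition ref_measure ::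
  "real \<Rightarrow> nat \<Rightarrow> (nat \<Rightarrow> real set) \<Rightarrow> (real \<Rightarrow> real \<Rightarrow> real) \<Rightarrow> (real \<Rightarrow> real \<Rightarrow> real) \<Rightarrow>
     real measure \<Rightarrow> (nat \<Rightarrow> real) measure" where
  "ref_measure h N X \<mu> \<sigma> \<rho>\<^sub>0 =
     restrict_space
       (distr (noise_law N \<rho>\<^sub>0) (\<Pi>\<^sub>M k\<in>{..N}. borel) (\<lambda>(y, z). \<lambda>k\<in>{..N}. euler_chain h \<mu> \<sigma> y z k))
       (\<Pi>\<^sub>E k\<in>{..N}. X k)"

text \<open>The relative entropy with the normalisation \<open>E\<^sub>P[log (dP/dQ) - 1]\<close>.\<close>

definition KL :: "'a measure \<Rightarrow> 'a measure \<Rightarrow> ereal" where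
  "KL P Q =
     (if absolutely_continuous Q P
      then ext_integral P (\<lambda>\<omega>. ereal (ln (enn2real (RN_deriv Q P \<omega>)) - 1))
      else \<infinity>)"


section \<open>The pairing of test functions and measures\<close>

text \<open>Elements are triples of families. Only the indices \<open>k < N\<close> and \<open>i \<in> I k\<close>, the values of
  functions on \<open>X k\<close> and the values of set functions on Borel subsets of \<open>X k\<close> are
  constrained and used, so that triples agreeing there represent the same element.\<close>

type_synonym ('k, 'i) test =
  "(nat \<Rightarrow> real \<Rightarrow> real) \<times> (nat \<Rightarrow> real \<Rightarrow> real ^ 'k) \<times> (nat \<Rightarrow> 'i \<Rightarrow> real)"

type_synonym ('k, 'i) dual =
  "(nat \<Rightarrow> real set \<Rightarrow> real) \<times> (nat \<Rightarrow> real set \<Rightarrow> real ^ 'k) \<times> (nat \<Rightarrow> 'i \<Rightarrow> real)"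

definition bcont_on :: "'a::topological_space set \<Rightarrow> ('a \<Rightarrow> 'b::metric_space) \<Rightarrow> bool" where
  "bcont_on S f \<longleftrightarrow> continuous_on S f \<and> bounded (f ` S)"

definition test_space :: "nat \<Rightarrow> (nat \<Rightarrow> real set) \<Rightarrow> ('k::finite, 'i) test set" where
  "test_space N X = {(\<phi>, \<psi>, \<Lambda>). \<forall>k<N. bcont_on (X k) (\<phi> k) \<and> bcont_on (X k) (\<psi> k)}"

definition dual_space :: "nat \<Rightarrow> (nat \<Rightarrow> real set) \<Rightarrow> ('k::finite, 'i) dual set" where
  "dual_space N X =
     {(a, b, g). \<forall>k<N. vector_measure (state_space X k) (a k) \<and>
                       vector_measure (state_space X k) (b k)}"

fun pairing ::
  "nat \<Rightarrow> (nat \<Rightarrow> real set) \<Rightarrow> (nat \<Rightarrow> 'i set) \<Rightarrow> ('k::finite, 'i) test \<Rightarrow> ('k, 'i) dual \<Rightarrow> real"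
where
  "pairing N X I (\<phi>, \<psi>, \<Lambda>) (a, b, g) =
     (\<Sum>k<N. signed_integral (state_space X k) (a k) (\<phi> k)
          + vector_integral (state_space X k) (b k) (\<psi> k)
          + (\<Sum>i\<in>I k. \<Lambda> k i * g k i))"

text \<open>The weak topology of the pairing.\<close>

definition weak_topology ::
  "nat \<Rightarrow> (nat \<Rightarrow> real set) \<Rightarrow> (nat \<Rightarrow> 'i set) \<Rightarrow> ('k::finite, 'i) dual topology" where
  "weak_topology N X I =
     topology_generated_by
       {{\<xi> \<in> dual_space N X. pairing N X I \<Phi> \<xi> \<in> U} |\<Phi> U. \<Phi> \<in> test_space N X \<and> open U}"

fun dual_comb :: "real \<Rightarrow> ('k::finite, 'i) dual \<Rightarrow> ('k, 'i) dual \<Rightarrow> ('k, 'i) dual" where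
  "dual_comb t (a, b, g) (a', b', g') =
     (\<lambda>k A. t * a k A + (1 - t) * a' k A,
      \<lambda>k A. t *\<^sub>R b k A + (1 - t) *\<^sub>R b' k A,
      \<lambda>k i. t * g k i + (1 - t) * g' k i)"

fun Delta ::
  "real \<Rightarrow> nat \<Rightarrow> (real \<Rightarrow> real \<Rightarrow> real ^ 'k) \<Rightarrow> (nat \<Rightarrow> 'i set) \<Rightarrow> ('i \<Rightarrow> real \<Rightarrow> real) \<Rightarrow>
     ('k::finite, 'i) test \<Rightarrow> (nat \<Rightarrow> real) \<Rightarrow> real" where
  "Delta h N B I G (\<phi>, \<psi>, \<Lambda>) x =
     (\<Sum>k<N. h * \<phi> k (x k) + \<psi> k (x k) \<bullet> B (x k) (x (Suc k))
          + (\<Sum>i\<in>I k. \<Lambda> k i * G i (x k)))"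

text \<open>The law \<open>\<nu>\<^sub>k\<close> of \<open>X\<^sub>k\<close>, the vector measure \<open>m\<^sub>k\<close> and the prices \<open>g\<^sub>k\<close> associated with
  a finite (not necessarily probability) measure \<open>P\<close> on the path space.\<close>

definition marginal ::
  "(nat \<Rightarrow> real set) \<Rightarrow> (nat \<Rightarrow> real) measure \<Rightarrow> nat \<Rightarrow> real measure" where
  "marginal X P k = distr P (state_space X k) (\<lambda>x. x k)"

definition moment_measure ::
  "real \<Rightarrow> (nat \<Rightarrow> real set) \<Rightarrow> (real \<Rightarrow> real \<Rightarrow> real ^ 'k) \<Rightarrow>
     (nat \<Rightarrow> real) measure \<Rightarrow> nat \<Rightarrow> real set \<Rightarrow> real ^ 'k" where
  "moment_measure h X B P k A =
     (LINT x:A|marginal X P k.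
        (1 / h) *\<^sub>R cond_exp_given P (state_space X k) (\<lambda>x. x k) (\<lambda>x. B (x k) (x (Suc k))) x)"

definition price :: "('i \<Rightarrow> real \<Rightarrow> real) \<Rightarrow> (nat \<Rightarrow> real) measure \<Rightarrow> nat \<Rightarrow> 'i \<Rightarrow> real" where
  "price G P k i = (\<integral>x. G i (x k) \<partial>P)"

definition Delta_adj ::
  "real \<Rightarrow> (nat \<Rightarrow> real set) \<Rightarrow> (real \<Rightarrow> real \<Rightarrow> real ^ 'k) \<Rightarrow> ('i \<Rightarrow> real \<Rightarrow> real) \<Rightarrow>
     (nat \<Rightarrow> real) measure \<Rightarrow> ('k::finite, 'i) dual" where
  "Delta_adj h X B G P =
     (\<lambda>k A. h * measure (marginal X P k) A, \<lambda>k A. h *\<^sub>R moment_measure h X B P k A, price G P)"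


section \<open>The primal and the dual functional\<close>

definition M_init :: "(nat \<Rightarrow> real set) \<Rightarrow> real measure \<Rightarrow> (real set \<Rightarrow> real) \<Rightarrow> ereal" where
  "M_init X \<nu>\<^sub>0 \<nu> = (if \<forall>A\<in>sets (state_space X 0). \<nu> A = measure \<nu>\<^sub>0 A then 0 else \<infinity>)"

text \<open>The argument of \<open>F_h\<close> is \<open>({h \<nu>\<^sub>k}, {h m\<^sub>k}, {g\<^sub>k})\<close>, hence the divisions by \<open>h\<close>.\<close>

fun F_h ::
  "real \<Rightarrow> nat \<Rightarrow> (nat \<Rightarrow> real set) \<Rightarrow> (nat \<Rightarrow> 'i set) \<Rightarrow> (nat \<Rightarrow> ('i \<Rightarrow> real) \<Rightarrow> ereal) \<Rightarrow>
     (real ^ 'k \<Rightarrow> ereal) \<Rightarrow> real measure \<Rightarrow> ('k::finite, 'i) dual \<Rightarrow> ereal" where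
  "F_h h N X I C F \<nu>\<^sub>0 (a, b, g) =
     (let \<nu> = (\<lambda>k A. a k A / h); m = (\<lambda>k A. b k A /\<^sub>R h); S = state_space X
      in if (\<forall>k<N. \<forall>A\<in>sets (S k). 0 \<le> \<nu> k A \<and> (\<nu> k A = 0 \<longrightarrow> m k A = 0))
         then (\<Sum>k<N. ereal h * ext_integral (jordan_pos (S k) (\<nu> k))
                            (\<lambda>x. F (vector_RN_deriv (jordan_pos (S k) (\<nu> k)) (m k) x))
                    + C k (restrict (g k) (I k)))
              + M_init X \<nu>\<^sub>0 (\<nu> 0)
         else \<infinity>)"

definition conjugate ::
  "nat \<Rightarrow> (nat \<Rightarrow> real set) \<Rightarrow> (nat \<Rightarrow> 'i set) \<Rightarrow> (('k::finite, 'i) dual \<Rightarrow> ereal) \<Rightarrow>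
     ('k, 'i) test \<Rightarrow> ereal" where
  "conjugate N X I f \<Phi> = (SUP \<xi>\<in>dual_space N X. ereal (pairing N X I \<Phi> \<xi>) - f \<xi>)"

definition dual_objective ::
  "real \<Rightarrow> nat \<Rightarrow> (nat \<Rightarrow> real set) \<Rightarrow> (nat \<Rightarrow> 'i set) \<Rightarrow> (real \<Rightarrow> real \<Rightarrow> real ^ 'k) \<Rightarrow>
     ('i \<Rightarrow> real \<Rightarrow> real) \<Rightarrow> (('k::finite, 'i) dual \<Rightarrow> ereal) \<Rightarrow> (nat \<Rightarrow> real) measure \<Rightarrow>
     ('k, 'i) test \<Rightarrow> ereal" where
  "dual_objective h N X I B G f Q \<Phi> =
     - conjugate N X I f (- \<Phi>) - ereal (h * (\<integral>x. exp (Delta h N B I G \<Phi> x / h) \<partial>Q))"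

definition primal_objective ::
  "real \<Rightarrow> (nat \<Rightarrow> real set) \<Rightarrow> (real \<Rightarrow> real \<Rightarrow> real ^ 'k) \<Rightarrow> ('i \<Rightarrow> real \<Rightarrow> real) \<Rightarrow>
     (('k::finite, 'i) dual \<Rightarrow> ereal) \<Rightarrow> (nat \<Rightarrow> real) measure \<Rightarrow>
     (nat \<Rightarrow> real) measure \<Rightarrow> ereal" where
  "primal_objective h X B G f Q P = f (Delta_adj h X B G P) + ereal h * KL P Q"

text \<open>The measure with density \<open>exp (\<Delta>\<Phi> / h)\<close> with respect to \<open>Q\<close>.\<close>

definition induced_measure ::
  "real \<Rightarrow> nat \<Rightarrow> (nat \<Rightarrow> 'i set) \<Rightarrow> (real \<Rightarrow> real \<Rightarrow> real ^ 'k) \<Rightarrow> ('i \<Rightarrow> real \<Rightarrow> real) \<Rightarrow>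
     (nat \<Rightarrow> real) measure \<Rightarrow> ('k::finite, 'i) test \<Rightarrow> (nat \<Rightarrow> real) measure" where
  "induced_measure h N I B G Q \<Phi> = density Q (\<lambda>x. ennreal (exp (Delta h N B I G \<Phi> x / h)))"

end

theory Submission
  imports Defs
begin

text \<open>Perturbing the maximiser \<open>\<Phi>\<close> linearly and comparing first-order terms shows that
  \<open>\<xi> = \<Delta>\<^sup>\<dagger> P\<^sup>h\<close> is a subgradient of the convex function \<open>\<F>\<^sup>\<star>\<close> at \<open>-\<Phi>\<close>. Since \<open>\<F>\<close> is proper, convex
  and weakly lower semicontinuous, the Fenchel-Moreau theorem turns this into
  \<open>\<F>(\<xi>) = - \<langle>\<Phi>, \<xi>\<rangle> - \<F>\<^sup>\<star>(-\<Phi>)\<close>, so that the primal value at \<open>P\<^sup>h\<close> is \<open>- \<F>\<^sup>\<star>(-\<Phi>) - h\<close>. For any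
  other probability measure \<open>P\<close>, the Fenchel-Young inequality leaves
  \<open>h E\<^sub>P[log dP/dP\<^sup>h] - \<F>\<^sup>\<star>(-\<Phi>) - h\<close> as a lower bound, and the relative entropy is positive unless
  \<open>P = P\<^sup>h\<close>. That \<open>P\<^sup>h\<close> has mass one comes from the imposed initial law.\<close>

section \<open>Fenchel-Moreau duality for a weak topology\<close>

text \<open>The elements of E and of its dual are triples of functions that count only through the
  pairing, and the weak topology is generated by the pairing alone. Fenchel-Moreau is therefore
  proved for an abstract bilinear pairing, where separation becomes a finite-dimensional question
  about a nearest point. The integral against a signed measure is defined through the Jordan parts,
  which do not depend linearly on the measure. Linearity of the pairing and the adjoint relation for
  \<open>Delta\<close> must be recovered from expressions that depend on the values of the set
  function only. The dual problem does not normalise the density \<open>exp (Delta / h)\<close>, so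
  the adjoint and the first-order condition are set up for finite measures; mass one enters when
  entropies are compared. The term -1 in the entropy fits this: it makes the unnormalised
  exponential the conjugate of \<open>x (ln x - 1)\<close>, and it is the origin of the constant -h
  in the optimal value.\<close>

lemma convex_set_separation_from_zero:
  fixes D :: "('j \<Rightarrow> real) set"
  assumes J: "finite J" and ne: "D \<noteq> {}"
    and conv: "\<And>x y t. x \<in> D \<Longrightarrow> y \<in> D \<Longrightarrow> 0 < t \<Longrightarrow> t < 1 \<Longrightarrow> (\<lambda>j. t * x j + (1 - t) * y j) \<in> D"
    and dist: "\<And>x. x \<in> D \<Longrightarrow> \<delta> \<le> (\<Sum>j\<in>J. (x j)\<^sup>2)"
  shows "\<exists>w. \<forall>x\<in>D. \<delta> \<le> (\<Sum>j\<in>J. w j * x j)"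
proof -
  define q :: "('j \<Rightarrow> real) \<Rightarrow> real" where "q x = (\<Sum>j\<in>J. (x j)\<^sup>2)" for x
  \<comment> \<open>\<open>m\<close> is the squared distance from the origin. The separating
    functional will be the nearest point \<open>w\<close> of the closure of \<open>D\<close>: moving
    from \<open>w\<close> towards any \<open>y\<close> in \<open>D\<close> cannot shorten it, so the
    inner product of \<open>w\<close> and \<open>y\<close> is at least
    \<open>q w = m\<close>.\<close>
  define m where "m = Inf (q ` D)"
  have bdd: "bdd_below (q ` D)"
    by (rule bdd_belowI[of _ 0]) (auto simp: q_def intro: sum_nonneg)
  have m_le: "m \<le> q x" if "x \<in> D" for x
    unfolding m_def using bdd that by (intro cInf_lower) auto
  have "\<delta> \<le> m"
    unfolding m_def using ne dist by (intro cInf_greatest) (auto simp: q_def)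
  have "\<exists>x\<in>D. q x < m + 1 / real (Suc n)" for n
    using cInf_less_iff[OF _ bdd, of "m + 1 / real (Suc n)"] ne by (auto simp: m_def)
  then obtain s where s: "\<And>n. s n \<in> D" "\<And>n. q (s n) < m + 1 / real (Suc n)"
    by metis
  \<comment> \<open>Parallelogram law. A midpoint stays in \<open>D\<close> and has \<open>q\<close>
    at least \<open>m\<close>, so a minimising sequence is Cauchy in each coordinate of
    \<open>J\<close>. The coefficient \<open>1 - 1/2\<close> is kept to match the convexity
    assumption.\<close>
  have parallelogram:
    "q (\<lambda>j. x j - y j) = 2 * q x + 2 * q y - 4 * q (\<lambda>j. (1/2) * x j + (1 - 1/2) * y j)" for x y
    unfolding q_def
    by (simp add: sum_distrib_left sum.distrib[symmetric] sum_subtractf[symmetric]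
        power2_eq_square algebra_simps)
  have close: "(s n j - s k j)\<^sup>2 < 4 / real (Suc M)" if "j \<in> J" "M \<le> n" "M \<le> k" for j n k M
  proof -
    have "(s n j - s k j)\<^sup>2 \<le> q (\<lambda>j. s n j - s k j)"
      unfolding q_def using that(1) J by (intro member_le_sum) auto
    also have "\<dots> < 2 * (m + 1 / real (Suc n)) + 2 * (m + 1 / real (Suc k)) - 4 * m"
      using s(2)[of n] s(2)[of k] m_le[OF conv[OF s(1)[of n] s(1)[of k], of "1/2"]]
      unfolding parallelogram by simp
    also have "\<dots> = 2 * (1 / real (Suc n)) + 2 * (1 / real (Suc k))"
      by simp
    also have "\<dots> \<le> 2 * (1 / real (Suc M)) + 2 * (1 / real (Suc M))"
      using that by (intro add_mono mult_left_mono divide_left_mono) auto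
    finally show ?thesis by simp
  qed
  have "convergent (\<lambda>n. s n j)" if "j \<in> J" for j
  proof (rule Cauchy_convergent, rule CauchyI)
    fix e :: real assume "0 < e"
    then obtain M where M: "1 / real (Suc M) < e\<^sup>2 / 4"
      using nat_approx_posE[of "e\<^sup>2 / 4"] by (metis divide_pos_pos zero_less_numeral zero_less_power)
    have "norm (s n j - s k j) < e" if "M \<le> n" "M \<le> k" for n k
    proof (rule power2_less_imp_less)
      show "(norm (s n j - s k j))\<^sup>2 < e\<^sup>2"
        using close[OF \<open>j \<in> J\<close> that] M by simp
    qed (use \<open>0 < e\<close> in simp)
    then show "\<exists>M. \<forall>m\<ge>M. \<forall>n\<ge>M. norm (s m j - s n j) < e" by blast
  qed
  then obtain w where w: "\<And>j. j \<in> J \<Longrightarrow> (\<lambda>n. s n j) \<longlonglongrightarrow> w j"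
    unfolding convergent_def by metis
  have "(\<lambda>n. q (s n)) \<longlonglongrightarrow> q w"
    unfolding q_def by (intro tendsto_sum tendsto_power w)
  moreover have "(\<lambda>n. q (s n)) \<longlonglongrightarrow> m"
  proof (rule tendsto_sandwich[of "\<lambda>_. m" _ _ "\<lambda>n. m + 1 / real (Suc n)"])
    show "(\<lambda>n. m + 1 / real (Suc n)) \<longlonglongrightarrow> m"
      using tendsto_add[OF tendsto_const[of m] LIMSEQ_inverse_real_of_nat]
      by (simp add: inverse_eq_divide)
  qed (use m_le s in \<open>auto simp: less_imp_le\<close>)
  ultimately have qw: "q w = m"
    by (rule LIMSEQ_unique)
  have "\<delta> \<le> (\<Sum>j\<in>J. w j * y j)" if y: "y \<in> D" for y
  proof -
    define a where "a = (\<Sum>j\<in>J. w j * (y j - w j))"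
    define b where "b = q (\<lambda>j. y j - w j)"
    \<comment> \<open>\<open>w\<close> need not lie in \<open>D\<close>, so the bound
      \<open>m\<close> is applied to combinations of \<open>y\<close> with \<open>s n\<close> and
      passed to the limit. The squared norm of \<open>w + t (y - w)\<close> is
      \<open>q w + t (2 a + t b)\<close>; dividing by \<open>t\<close> leaves this inequality, and t
      tending to 0 yields that \<open>a\<close> is nonnegative.\<close>
    have ineq: "0 \<le> 2 * a + t * b" if t: "0 < t" "t < 1" for t
    proof -
      have "(\<lambda>n. q (\<lambda>j. t * y j + (1 - t) * s n j)) \<longlonglongrightarrow> q (\<lambda>j. t * y j + (1 - t) * w j)"
        unfolding q_def by (intro tendsto_intros w)
      moreover have "m \<le> q (\<lambda>j. t * y j + (1 - t) * s n j)" for n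
        by (rule m_le[OF conv[OF y s(1) t]])
      ultimately have "m \<le> q (\<lambda>j. t * y j + (1 - t) * w j)"
        by (intro LIMSEQ_le_const) auto
      also have "\<dots> = q w + t * (2 * a + t * b)"
        unfolding q_def a_def b_def
        by (simp add: sum_distrib_left sum.distrib[symmetric] power2_eq_square algebra_simps)
      finally show ?thesis
        using qw t by (simp add: zero_le_mult_iff)
    qed
    have "((\<lambda>t. 2 * a + t * b) \<longlongrightarrow> 2 * a + 0 * b) (at_right 0)"
      by (intro tendsto_intros)
    moreover have "eventually (\<lambda>t. 0 \<le> 2 * a + t * b) (at_right 0)"
      using ineq by (auto simp: eventually_at_right_field intro!: exI[of _ 1])
    ultimately have "0 \<le> 2 * a + 0 * b"
      by (intro tendsto_lowerbound) auto
    moreover have "a = (\<Sum>j\<in>J. w j * y j) - q w"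
      unfolding a_def q_def by (simp add: sum_subtractf[symmetric] power2_eq_square algebra_simps)
    ultimately show ?thesis
      using qw \<open>\<delta> \<le> m\<close> by simp
  qed
  then show ?thesis by blast
qed

text \<open>Different triples may represent the same element, so no vector space structure is
  imposed: \<open>lin\<close> and \<open>comb\<close> are characterised by what the pairing does to
  them. With two coefficients, \<open>lin\<close> covers scalar multiples and segments
  alike.\<close>

locale weak_duality =
  fixes E :: "'e set" and S :: "'d set" and p :: "'e \<Rightarrow> 'd \<Rightarrow> real"
    and lin :: "real \<Rightarrow> 'e \<Rightarrow> real \<Rightarrow> 'e \<Rightarrow> 'e" and comb :: "real \<Rightarrow> 'd \<Rightarrow> 'd \<Rightarrow> 'd"
  assumes E_nonempty: "E \<noteq> {}"
    and lin_mem: "\<Phi> \<in> E \<Longrightarrow> \<Psi> \<in> E \<Longrightarrow> lin a \<Phi> b \<Psi> \<in> E"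
    and pair_lin: "\<Phi> \<in> E \<Longrightarrow> \<Psi> \<in> E \<Longrightarrow> \<xi> \<in> S \<Longrightarrow> p (lin a \<Phi> b \<Psi>) \<xi> = a * p \<Phi> \<xi> + b * p \<Psi> \<xi>"
    and comb_mem: "\<xi> \<in> S \<Longrightarrow> \<eta> \<in> S \<Longrightarrow> comb t \<xi> \<eta> \<in> S"
    and pair_comb:
      "\<Phi> \<in> E \<Longrightarrow> \<xi> \<in> S \<Longrightarrow> \<eta> \<in> S \<Longrightarrow> p \<Phi> (comb t \<xi> \<eta>) = t * p \<Phi> \<xi> + (1 - t) * p \<Phi> \<eta>"
begin

definition weak :: "'d topology" where
  "weak = topology_generated_by {{\<xi> \<in> S. p \<Phi> \<xi> \<in> U} |\<Phi> U. \<Phi> \<in> E \<and> open U}"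

definition conj :: "('d \<Rightarrow> ereal) \<Rightarrow> 'e \<Rightarrow> ereal" where
  "conj f \<Phi> = (SUP \<xi>\<in>S. ereal (p \<Phi> \<xi>) - f \<xi>)"

lemma topspace_weak: "topspace weak = S"
  using E_nonempty unfolding weak_def topology_generated_by_topspace by auto

text \<open>Induction over the generation of the topology: an intersection joins the two finite sets
  of test elements and keeps the smaller radius, a union inherits from one member, and a generating
  set needs a single test element.\<close>

lemma weak_nhd:
  assumes "openin weak U" and "x \<in> U"
  shows "\<exists>T \<epsilon>. finite T \<and> T \<subseteq> E \<and> 0 < \<epsilon> \<and> (\<forall>\<xi>\<in>S. (\<forall>\<Psi>\<in>T. \<bar>p \<Psi> \<xi> - p \<Psi> x\<bar> < \<epsilon>) \<longrightarrow> \<xi> \<in> U)"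
proof -
  have "generate_topology_on {{\<xi> \<in> S. p \<Phi> \<xi> \<in> U} |\<Phi> U. \<Phi> \<in> E \<and> open U} U"
    using assms(1) unfolding weak_def openin_topology_generated_by_iff .
  then show ?thesis
    using assms(2)
  proof (induction rule: generate_topology_on.induct)
    case Empty
    then show ?case by simp
  next
    case (Int U V)
    from Int.IH(1) Int.prems obtain T \<epsilon> where
      "finite T" "T \<subseteq> E" "0 < \<epsilon>" "\<forall>\<xi>\<in>S. (\<forall>\<Psi>\<in>T. \<bar>p \<Psi> \<xi> - p \<Psi> x\<bar> < \<epsilon>) \<longrightarrow> \<xi> \<in> U"
      by blast
    moreover from Int.IH(2) Int.prems obtain T' \<epsilon>' where
      "finite T'" "T' \<subseteq> E" "0 < \<epsilon>'" "\<forall>\<xi>\<in>S. (\<forall>\<Psi>\<in>T'. \<bar>p \<Psi> \<xi> - p \<Psi> x\<bar> < \<epsilon>') \<longrightarrow> \<xi> \<in> V"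
      by blast
    ultimately show ?case
      by (intro exI[of _ "T \<union> T'"] exI[of _ "min \<epsilon> \<epsilon>'"]) (simp add: ball_Un)
  next
    case (UN K)
    then obtain k where "k \<in> K" "x \<in> k" by blast
    from UN.IH[OF this] obtain T \<epsilon> where
      "finite T" "T \<subseteq> E" "0 < \<epsilon>" "\<forall>\<xi>\<in>S. (\<forall>\<Psi>\<in>T. \<bar>p \<Psi> \<xi> - p \<Psi> x\<bar> < \<epsilon>) \<longrightarrow> \<xi> \<in> k"
      by blast
    then show ?case using \<open>k \<in> K\<close> by blast
  next
    case (Basis s)
    then obtain \<Phi> V where s: "s = {\<xi> \<in> S. p \<Phi> \<xi> \<in> V}" "\<Phi> \<in> E" "open V" by blast
    then obtain \<epsilon> where "0 < \<epsilon>" "\<forall>y. dist y (p \<Phi> x) < \<epsilon> \<longrightarrow> y \<in> V"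
      using Basis.prems by (auto simp: open_dist)
    then show ?case
      using s by (intro exI[of _ "{\<Phi>}"] exI[of _ \<epsilon>]) (auto simp: dist_real_def)
  qed
qed

lemma pair_lincomb:
  assumes "finite T" and "T \<subseteq> E"
  shows "\<exists>\<Psi>\<in>E. \<forall>\<xi>\<in>S. p \<Psi> \<xi> = (\<Sum>\<Theta>\<in>T. w \<Theta> * p \<Theta> \<xi>)"
  using assms
proof (induction rule: finite_induct)
  case empty
  obtain \<Phi> where "\<Phi> \<in> E" using E_nonempty by blast
  then show ?case
    by (intro bexI[of _ "lin 0 \<Phi> 0 \<Phi>"]) (auto simp: pair_lin lin_mem)
next
  case (insert \<Theta> T)
  then obtain \<Psi> where "\<Psi> \<in> E" "\<forall>\<xi>\<in>S. p \<Psi> \<xi> = (\<Sum>\<Theta>\<in>T. w \<Theta> * p \<Theta> \<xi>)" by auto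
  then show ?case
    using insert by (intro bexI[of _ "lin (w \<Theta>) \<Theta> 1 \<Psi>"]) (auto simp: pair_lin lin_mem)
qed

text \<open>A weak neighbourhood involves finitely many test elements only, so the epigraph of \<open>f\<close> can be
  separated from a point below it after projection to a finite-dimensional space.\<close>

lemma epigraph_separation:
  assumes proper: "proper_on S f" and conv: "convex_ext_on comb S f" and lsc: "lsc_in weak f"
    and x: "x \<in> S" and c: "ereal c < f x"
  shows "\<exists>\<Psi>\<in>E. \<exists>s \<delta>. 0 \<le> s \<and> 0 < \<delta> \<and>
           (\<forall>\<xi>\<in>S. \<forall>r. f \<xi> \<le> ereal r \<longrightarrow> \<delta> \<le> p \<Psi> \<xi> - p \<Psi> x + s * (r - c))"
proof -
  \<comment> \<open>A level strictly between \<open>c\<close> and \<open>f x\<close>: on a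
    neighbourhood of \<open>x\<close> the function stays above \<open>c'\<close>, so the epigraph
    keeps there a uniform vertical distance \<open>c' - c\<close> from height
    \<open>c\<close>.\<close>
  obtain c' where c': "c < c'" "ereal c' < f x"
    using ereal_dense2[OF c] by auto
  have "openin weak {\<xi> \<in> S. ereal c' < f \<xi>}"
    using lsc unfolding lsc_in_def topspace_weak by blast
  from weak_nhd[OF this, of x] x c' obtain T \<epsilon> where T: "finite T" "T \<subseteq> E" and "0 < \<epsilon>"
    and nhd: "\<And>\<xi>. \<xi> \<in> S \<Longrightarrow> (\<forall>\<Psi>\<in>T. \<bar>p \<Psi> \<xi> - p \<Psi> x\<bar> < \<epsilon>) \<Longrightarrow> ereal c' < f \<xi>"
    by auto
  \<comment> \<open>Coordinates relative to the point \<open>(x, c)\<close>: \<open>None\<close> is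
    the vertical one, \<open>Some \<Psi>\<close> the one seen by the test element
    \<open>\<Psi>\<close>. The point to be separated becomes the origin.\<close>
  define v where "v \<xi> r = case_option (r - c) (\<lambda>\<Psi>. p \<Psi> \<xi> - p \<Psi> x)" for \<xi> r
  define J where "J = insert None (Some ` T)"
  \<comment> \<open>A point of the epigraph either lies over the neighbourhood, with vertical
    coordinate at least \<open>c' - c\<close>, or has a tested coordinate of size at least
    \<open>\<epsilon>\<close>.\<close>
  define \<delta> where "\<delta> = min (\<epsilon>\<^sup>2) ((c' - c)\<^sup>2)"
  have "0 < \<delta>"
    using c' \<open>0 < \<epsilon>\<close> by (auto simp: \<delta>_def)
  have J: "finite J" using T by (auto simp: J_def)
  have sum_J: "(\<Sum>j\<in>J. g j) = g None + (\<Sum>\<Psi>\<in>T. g (Some \<Psi>))" for g :: "_ \<Rightarrow> real"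
    using T by (simp add: J_def sum.reindex)
  obtain \<xi>\<^sub>0 where xi0: "\<xi>\<^sub>0 \<in> S" "f \<xi>\<^sub>0 \<noteq> \<infinity>" "f \<xi>\<^sub>0 \<noteq> -\<infinity>"
    using proper unfolding proper_on_def by blast
  then obtain r\<^sub>0 where r0: "f \<xi>\<^sub>0 = ereal r\<^sub>0" by (cases "f \<xi>\<^sub>0") auto
  \<comment> \<open>Only the coordinates in \<open>J\<close> are prescribed:
    \<open>pair_comb\<close> holds for test elements in \<open>E\<close>, so a combination of points
    agrees with \<open>v\<close> there and may differ elsewhere.\<close>
  define D' where "D' = {y. \<exists>\<xi> r. \<xi> \<in> S \<and> f \<xi> \<le> ereal r \<and> (\<forall>j\<in>J. y j = v \<xi> r j)}"
  have "\<exists>w. \<forall>y\<in>D'. \<delta> \<le> (\<Sum>j\<in>J. w j * y j)"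
  proof (rule convex_set_separation_from_zero[OF J])
    show "D' \<noteq> {}"
      using xi0(1) r0 unfolding D'_def by (auto intro!: exI[of _ "v \<xi>\<^sub>0 r\<^sub>0"] exI[of _ \<xi>\<^sub>0] exI[of _ r\<^sub>0])
  next
    fix y y' :: "'e option \<Rightarrow> real" and t :: real
    assume "y \<in> D'" "y' \<in> D'" and t: "0 < t" "t < 1"
    then obtain \<xi> r \<xi>' r' where
      y: "\<xi> \<in> S" "f \<xi> \<le> ereal r" "\<forall>j\<in>J. y j = v \<xi> r j"
      and y': "\<xi>' \<in> S" "f \<xi>' \<le> ereal r'" "\<forall>j\<in>J. y' j = v \<xi>' r' j"
      unfolding D'_def by blast
    have "f (comb t \<xi> \<xi>') \<le> ereal t * f \<xi> + ereal (1 - t) * f \<xi>'"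
      using conv y y' t unfolding convex_ext_on_def by blast
    also have "\<dots> \<le> ereal t * ereal r + ereal (1 - t) * ereal r'"
      using y y' t by (intro add_mono ereal_mult_left_mono) auto
    also have "\<dots> = ereal (t * r + (1 - t) * r')" by simp
    finally have "f (comb t \<xi> \<xi>') \<le> ereal (t * r + (1 - t) * r')" .
    moreover have "t * y j + (1 - t) * y' j = v (comb t \<xi> \<xi>') (t * r + (1 - t) * r') j"
      if j: "j \<in> J" for j
    proof -
      have "t * v \<xi> r j + (1 - t) * v \<xi>' r' j = v (comb t \<xi> \<xi>') (t * r + (1 - t) * r') j"
        using j y(1) y'(1) T by (auto simp: v_def J_def pair_comb subset_iff algebra_simps)
      then show ?thesis using y(3) y'(3) j by simp
    qed
    ultimately show "(\<lambda>j. t * y j + (1 - t) * y' j) \<in> D'"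
      unfolding D'_def using comb_mem[OF y(1) y'(1)] by blast
  next
    fix y assume "y \<in> D'"
    then obtain \<xi> r where y: "\<xi> \<in> S" "f \<xi> \<le> ereal r" "\<forall>j\<in>J. y j = v \<xi> r j"
      unfolding D'_def by blast
    have "\<exists>j\<in>J. \<delta> \<le> (y j)\<^sup>2"
    proof (cases "\<forall>\<Psi>\<in>T. \<bar>p \<Psi> \<xi> - p \<Psi> x\<bar> < \<epsilon>")
      case True
      from nhd[OF y(1) this] y(2) have "ereal c' < ereal r" by (rule less_le_trans)
      then have "(c' - c)\<^sup>2 \<le> (r - c)\<^sup>2"
        using c' by (intro power_mono) auto
      then show ?thesis
        using y(3) by (intro bexI[of _ None]) (auto simp: \<delta>_def v_def J_def)
    next
      case False
      then obtain \<Psi> where "\<Psi> \<in> T" "\<epsilon> \<le> \<bar>p \<Psi> \<xi> - p \<Psi> x\<bar>" by auto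
      moreover from this have "\<epsilon>\<^sup>2 \<le> (p \<Psi> \<xi> - p \<Psi> x)\<^sup>2"
        using \<open>0 < \<epsilon>\<close> by (metis abs_of_pos abs_le_square_iff)
      ultimately show ?thesis
        using y(3) by (intro bexI[of _ "Some \<Psi>"]) (auto simp: \<delta>_def v_def J_def)
    qed
    then obtain j where "j \<in> J" "\<delta> \<le> (y j)\<^sup>2" by blast
    moreover have "(y j)\<^sup>2 \<le> (\<Sum>j\<in>J. (y j)\<^sup>2)"
      using \<open>j \<in> J\<close> J by (intro member_le_sum) auto
    ultimately show "\<delta> \<le> (\<Sum>j\<in>J. (y j)\<^sup>2)" by linarith
  qed
  then obtain w where w: "\<And>y. y \<in> D' \<Longrightarrow> \<delta> \<le> (\<Sum>j\<in>J. w j * y j)" by blast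
  obtain \<Psi> where \<Psi>: "\<Psi> \<in> E" "\<forall>\<xi>\<in>S. p \<Psi> \<xi> = (\<Sum>\<Theta>\<in>T. w (Some \<Theta>) * p \<Theta> \<xi>)"
    using pair_lincomb[OF T, of "\<lambda>\<Theta>. w (Some \<Theta>)"] by blast
  have main: "\<delta> \<le> p \<Psi> \<xi> - p \<Psi> x + w None * (r - c)" if "\<xi> \<in> S" "f \<xi> \<le> ereal r" for \<xi> r
  proof -
    have "v \<xi> r \<in> D'" using that unfolding D'_def by blast
    from w[OF this] show ?thesis
      using \<Psi>(2) that(1) x
      by (simp add: sum_J v_def right_diff_distrib sum_subtractf)
  qed
  \<comment> \<open>The epigraph extends upwards without bound, so a negative vertical weight would
    be exposed by a large \<open>r\<close>; the one chosen below makes the vertical term outweigh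
    \<open>z\<close>.\<close>
  have "0 \<le> w None"
  proof (rule ccontr)
    assume "\<not> 0 \<le> w None"
    then have neg: "w None < 0" by simp
    define z where "z = p \<Psi> \<xi>\<^sub>0 - p \<Psi> x"
    define r where "r = max r\<^sub>0 (c + \<bar>z\<bar> / (- w None))"
    have "\<delta> \<le> z + w None * (r - c)"
      using main[OF xi0(1), of r] r0 by (simp add: z_def r_def)
    moreover have "w None * (r - c) \<le> w None * (\<bar>z\<bar> / (- w None))"
      using neg by (intro mult_left_mono_neg) (auto simp: r_def)
    ultimately show False
      using neg \<open>0 < \<delta>\<close> by simp
  qed
  then show ?thesis
    using \<Psi>(1) \<open>0 < \<delta>\<close> main by blast
qed

lemma Fenchel_Young: "\<xi> \<in> S \<Longrightarrow> ereal (p \<Phi> \<xi>) - f \<xi> \<le> conj f \<Phi>"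
  unfolding conj_def by (rule SUP_upper)

text \<open>Points where \<open>f\<close> is infinite contribute nothing to the supremum, and
  properness excludes the value minus infinity. Upper bounds on the conjugate thus become
  inequalities between reals.\<close>

lemma conj_le_iff:
  assumes "proper_on S f"
  shows "conj f \<Phi> \<le> ereal b \<longleftrightarrow> (\<forall>\<xi>\<in>S. \<forall>r. f \<xi> = ereal r \<longrightarrow> p \<Phi> \<xi> - r \<le> b)"
proof -
  have "ereal (p \<Phi> \<xi>) - f \<xi> \<le> ereal b \<longleftrightarrow> (\<forall>r. f \<xi> = ereal r \<longrightarrow> p \<Phi> \<xi> - r \<le> b)" if "\<xi> \<in> S" for \<xi>
    using assms that by (cases "f \<xi>") (auto simp: proper_on_def)
  then show ?thesis
    unfolding conj_def SUP_le_iff by blast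
qed

lemma conj_not_MInf:
  assumes "proper_on S f"
  shows "conj f \<Phi> \<noteq> - \<infinity>"
proof -
  obtain \<xi> where "\<xi> \<in> S" "f \<xi> \<noteq> \<infinity>" "f \<xi> \<noteq> - \<infinity>"
    using assms unfolding proper_on_def by blast
  then show ?thesis
    using Fenchel_Young[of \<xi> \<Phi> f] by (cases "f \<xi>") auto
qed

text \<open>For \<open>0 < s\<close> the separating hyperplane is the graph of an affine function.
  Division by \<open>- s\<close> gives a minorant of \<open>f\<close> through the point
  \<open>(x, c)\<close>; \<open>lin\<close> with second coefficient 0 serves as scalar
  multiplication.\<close>

lemma conj_finite_nonvertical:
  assumes proper: "proper_on S f" and \<Psi>: "\<Psi> \<in> E" and "0 < s" and "0 < \<delta>" and x: "x \<in> S"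
    and sep: "\<forall>\<xi>\<in>S. \<forall>r. f \<xi> \<le> ereal r \<longrightarrow> \<delta> \<le> p \<Psi> \<xi> - p \<Psi> x + s * (r - c)"
  shows "conj f (lin (- (1 / s)) \<Psi> 0 \<Psi>) \<le> ereal (p (lin (- (1 / s)) \<Psi> 0 \<Psi>) x - c)"
proof -
  have "p (lin (- (1 / s)) \<Psi> 0 \<Psi>) \<xi> - r \<le> p (lin (- (1 / s)) \<Psi> 0 \<Psi>) x - c"
    if "\<xi> \<in> S" "f \<xi> = ereal r" for \<xi> r
  proof -
    have "0 \<le> p \<Psi> \<xi> - p \<Psi> x + s * (r - c)"
      using sep that \<open>0 < \<delta>\<close> by fastforce
    then have "0 \<le> (p \<Psi> \<xi> - p \<Psi> x) / s + (r - c)"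
      using \<open>0 < s\<close> by (simp add: field_simps)
    then show ?thesis
      using pair_lin[OF \<Psi> \<Psi> that(1)] pair_lin[OF \<Psi> \<Psi> x] by (simp add: diff_divide_distrib)
  qed
  then show ?thesis
    unfolding conj_le_iff[OF proper] by blast
qed

text \<open>A hyperplane separating the epigraph from the point one unit below a point of the graph
  cannot be vertical: tested at that graph point, the separation reads
  \<open>\<delta> \<le> s\<close>.\<close>

lemma conj_proper:
  assumes proper: "proper_on S f" and conv: "convex_ext_on comb S f" and lsc: "lsc_in weak f"
  shows "\<exists>\<Psi>\<in>E. conj f \<Psi> \<noteq> \<infinity>"
proof -
  obtain x where x: "x \<in> S" "f x \<noteq> \<infinity>" "f x \<noteq> - \<infinity>"
    using proper unfolding proper_on_def by blast
  then obtain b where b: "f x = ereal b" by (cases "f x") auto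
  then have "ereal (b - 1) < f x" by simp
  from epigraph_separation[OF proper conv lsc x(1) this] obtain \<Psi> s \<delta> where
    sep: "\<Psi> \<in> E" "0 \<le> s" "0 < \<delta>"
      "\<forall>\<xi>\<in>S. \<forall>r. f \<xi> \<le> ereal r \<longrightarrow> \<delta> \<le> p \<Psi> \<xi> - p \<Psi> x + s * (r - (b - 1))"
    by blast
  have "\<delta> \<le> p \<Psi> x - p \<Psi> x + s * (b - (b - 1))"
    using sep(4) x(1) b by (metis order_refl)
  then have "0 < s" using \<open>0 < \<delta>\<close> by simp
  from conj_finite_nonvertical[OF proper sep(1) this sep(3) x(1) sep(4)]
  have "conj f (lin (- (1 / s)) \<Psi> 0 \<Psi>) \<noteq> \<infinity>" by auto
  then show ?thesis using lin_mem[OF sep(1) sep(1)] by blast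
qed

text \<open>The substance is in the second inequality, and its difficulty is a vertical hyperplane,
  \<open>s = 0\<close>, which occurs only where \<open>f x\<close> is infinite. It supports no
  affine minorant by itself; a large multiple of it tilts a fixed minorant, supplied by
  \<open>conj_proper\<close>, above \<open>c\<close> at \<open>x\<close>.\<close>

theorem Fenchel_Moreau:
  assumes proper: "proper_on S f" and conv: "convex_ext_on comb S f" and lsc: "lsc_in weak f"
    and x: "x \<in> S"
  shows "f x = (SUP \<Psi>\<in>E. ereal (p \<Psi> x) - conj f \<Psi>)"
proof (rule antisym)
  show "(SUP \<Psi>\<in>E. ereal (p \<Psi> x) - conj f \<Psi>) \<le> f x"
  proof (rule SUP_least)
    fix \<Psi>
    show "ereal (p \<Psi> x) - conj f \<Psi> \<le> f x"
      using Fenchel_Young[OF x, of \<Psi> f] by (cases "f x"; cases "conj f \<Psi>") auto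
  qed
next
  show "f x \<le> (SUP \<Psi>\<in>E. ereal (p \<Psi> x) - conj f \<Psi>)"
  proof (rule ccontr)
    assume "\<not> ?thesis"
    then obtain c where c: "(SUP \<Psi>\<in>E. ereal (p \<Psi> x) - conj f \<Psi>) < ereal c" "ereal c < f x"
      using ereal_dense2 by (auto simp: not_le)
    from epigraph_separation[OF proper conv lsc x c(2)] obtain \<Psi> s \<delta> where
      sep: "\<Psi> \<in> E" "0 \<le> s" "0 < \<delta>"
        "\<forall>\<xi>\<in>S. \<forall>r. f \<xi> \<le> ereal r \<longrightarrow> \<delta> \<le> p \<Psi> \<xi> - p \<Psi> x + s * (r - c)"
      by blast
    have "\<exists>\<Theta>\<in>E. conj f \<Theta> \<le> ereal (p \<Theta> x - c)"
    proof (cases "s = 0")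
      case False
      then show ?thesis
        using conj_finite_nonvertical[OF proper sep(1) _ sep(3) x sep(4)] sep(2) lin_mem[OF sep(1) sep(1)]
        by fastforce
    next
      case True
      obtain \<Phi> where \<Phi>: "\<Phi> \<in> E" "conj f \<Phi> \<noteq> \<infinity>"
        using conj_proper[OF proper conv lsc] by blast
      then obtain a where a: "conj f \<Phi> = ereal a"
        using conj_not_MInf[OF proper, of \<Phi>] by (cases "conj f \<Phi>") auto
      \<comment> \<open>At \<open>x\<close> the minorant of slope \<open>\<Phi>\<close> may fall
        short of \<open>c\<close> by \<open>a + c - p \<Phi> x\<close>. On the domain of
        \<open>f\<close> the functional \<open>\<Psi>\<close> exceeds its value at \<open>x\<close>
        by \<open>\<delta>\<close>, so subtracting \<open>t\<close> times \<open>\<Psi>\<close>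
        gains \<open>t * \<delta>\<close>, enough to cover the shortfall.\<close>
      define t where "t = max 0 ((a + c - p \<Phi> x) / \<delta>)"
      have t: "0 \<le> t" "a + c - p \<Phi> x \<le> t * \<delta>"
        using \<open>0 < \<delta>\<close> by (auto simp: t_def max_def field_simps)
      have "p (lin 1 \<Phi> (- t) \<Psi>) \<xi> - r \<le> p (lin 1 \<Phi> (- t) \<Psi>) x - c"
        if "\<xi> \<in> S" "f \<xi> = ereal r" for \<xi> r
      proof -
        have "p \<Phi> \<xi> - r \<le> a"
          using conj_le_iff[OF proper, of \<Phi> a] a that by auto
        moreover have "\<delta> \<le> p \<Psi> \<xi> - p \<Psi> x"
          using sep(4) that True by (metis add.right_neutral mult_zero_left order_refl)
        then have "t * \<delta> \<le> t * (p \<Psi> \<xi> - p \<Psi> x)"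
          using t by (intro mult_left_mono)
        ultimately show ?thesis
          using pair_lin[OF \<Phi>(1) sep(1) that(1)] pair_lin[OF \<Phi>(1) sep(1) x] t
          by (simp add: right_diff_distrib)
      qed
      then show ?thesis
        using lin_mem[OF \<Phi>(1) sep(1)] conj_le_iff[OF proper] by blast
    qed
    then obtain \<Theta> where \<Theta>: "\<Theta> \<in> E" "conj f \<Theta> \<le> ereal (p \<Theta> x - c)" by blast
    then have "ereal c \<le> ereal (p \<Theta> x) - conj f \<Theta>"
      by (cases "conj f \<Theta>") auto
    also have "\<dots> \<le> (SUP \<Psi>\<in>E. ereal (p \<Psi> x) - conj f \<Psi>)"
      using \<Theta>(1) by (rule SUP_upper)
    finally show False using c(1) by simp
  qed
qed

end

section \<open>Signed measures\<close>

lemma vector_measure_sums: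
  "vector_measure S \<mu> \<Longrightarrow> range A \<subseteq> sets S \<Longrightarrow> disjoint_family A \<Longrightarrow> (\<lambda>n. \<mu> (A n)) sums \<mu> (\<Union>n::nat. A n)"
  unfolding vector_measure_def by blast

text \<open>Empty sets form a disjoint sequence, and a constant series converges only if its term
  vanishes.\<close>

lemma vector_measure_empty:
  assumes "vector_measure S \<mu>"
  shows "\<mu> {} = 0"
proof -
  have "(\<lambda>n::nat. \<mu> {}) sums \<mu> (\<Union>n::nat. {})"
    using assms[unfolded vector_measure_def, rule_format, of "\<lambda>_. {}"]
    by (simp add: disjoint_family_on_def image_subset_iff)
  from sums_summable[OF this] show ?thesis
    by (simp add: summable_const_iff)
qed

lemma vector_measure_Un:
  assumes vm: "vector_measure S \<mu>" and "A \<in> sets S" "B \<in> sets S" "A \<inter> B = {}"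
  shows "\<mu> (A \<union> B) = \<mu> A + \<mu> B"
proof -
  have "range (binaryset A B) \<subseteq> sets S"
    using assms by (auto simp: range_binaryset_eq)
  moreover have "disjoint_family (binaryset A B)"
    using assms(4) by (auto simp: disjoint_family_on_def binaryset_def)
  ultimately have "(\<lambda>n. \<mu> (binaryset A B n)) sums \<mu> (\<Union>n. binaryset A B n)"
    using vm unfolding vector_measure_def by blast
  moreover have "(\<lambda>n. \<mu> (binaryset A B n)) sums (\<mu> A + \<mu> B)"
    by (rule binaryset_sums) (rule vector_measure_empty[OF vm])
  ultimately show ?thesis
    by (simp add: UN_binaryset_eq sums_iff)
qed

lemma vector_measure_Diff:
  assumes "vector_measure S \<mu>" and "A \<in> sets S" "B \<in> sets S" "B \<subseteq> A"
  shows "\<mu> (A - B) = \<mu> A - \<mu> B"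
  using vector_measure_Un[OF assms(1), of "A - B" B] assms
  by (simp add: Un_absorb2 Diff_disjoint Int_commute)

lemma vector_measure_uminus: "vector_measure S \<mu> \<Longrightarrow> vector_measure S (\<lambda>A. - \<mu> A)"
  unfolding vector_measure_def by (auto intro: sums_minus)

lemma vector_measure_lin:
  fixes \<mu> \<mu>' :: "'a set \<Rightarrow> 'b::real_normed_vector"
  assumes "vector_measure S \<mu>" "vector_measure S \<mu>'"
  shows "vector_measure S (\<lambda>A. t *\<^sub>R \<mu> A + u *\<^sub>R \<mu>' A)"
  using assms unfolding vector_measure_def by (auto intro!: sums_add sums_scaleR_right)

lemma vector_measure_component:
  fixes m :: "'a set \<Rightarrow> real ^ 'k::finite"
  assumes "vector_measure S m"
  shows "vector_measure S (\<lambda>A. m A $ j)"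
  using assms unfolding vector_measure_def
  by (auto intro: bounded_linear.sums[OF bounded_linear_vec_nth])

text \<open>Finiteness of the Jordan parts rests on this. Otherwise any set with unbounded values on
  its subsets splits into two pieces of absolute value above 1, one of them again of this kind.
  Iterating produces disjoint pieces whose values do not tend to 0, against countable
  additivity.\<close>

lemma signed_measure_bounded:
  fixes \<mu> :: "'a set \<Rightarrow> real"
  assumes vm: "vector_measure S \<mu>"
  shows "\<exists>K. \<forall>A\<in>sets S. \<bar>\<mu> A\<bar> \<le> K"
proof (rule ccontr)
  define unb where "unb A \<longleftrightarrow> A \<in> sets S \<and> (\<forall>K. \<exists>D\<in>sets S. D \<subseteq> A \<and> K < \<bar>\<mu> D\<bar>)" for A
  assume *: "\<nexists>K. \<forall>A\<in>sets S. \<bar>\<mu> A\<bar> \<le> K"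
  have "\<exists>D\<in>sets S. D \<subseteq> space S \<and> K < \<bar>\<mu> D\<bar>" for K
  proof -
    obtain D where "D \<in> sets S" "\<not> \<bar>\<mu> D\<bar> \<le> K" using * by blast
    then show ?thesis using sets.sets_into_space by (intro bexI[of _ D]) auto
  qed
  then have unb_space: "unb (space S)"
    unfolding unb_def by blast
  have unbD: "\<exists>D\<in>sets S. D \<subseteq> A \<and> K < \<bar>\<mu> D\<bar>" if "unb A" for A K
    using that by (simp add: unb_def)
  have not_unbD: "\<exists>K. \<forall>H. H \<in> sets S \<longrightarrow> H \<subseteq> A \<longrightarrow> \<bar>\<mu> H\<bar> \<le> K"
    if "\<not> unb A" "A \<in> sets S" for A
    using that unfolding unb_def by (meson not_le)
  have step: "\<exists>A'. unb A' \<and> A' \<subseteq> A \<and> 1 < \<bar>\<mu> (A - A')\<bar>" if uA: "unb A" for A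
  proof -
    \<comment> \<open>The threshold \<open>1 + \<bar>\<mu> A\<bar>\<close> makes both pieces large,
      since \<open>\<mu> (A - D) = \<mu> A - \<mu> D\<close>; hence it does not matter which of them
      stays unbounded.\<close>
    obtain D where D: "D \<in> sets S" "D \<subseteq> A" "1 + \<bar>\<mu> A\<bar> < \<bar>\<mu> D\<bar>"
      using unbD[OF uA] by blast
    have A: "A \<in> sets S" using uA by (simp add: unb_def)
    have diff: "\<mu> (A - D) = \<mu> A - \<mu> D"
      using vm A D by (intro vector_measure_Diff)
    have "unb D \<or> unb (A - D)"
    proof (rule ccontr)
      assume "\<not> ?thesis"
      then have "\<not> unb D" "\<not> unb (A - D)" by auto
      from not_unbD[OF this(1)] not_unbD[OF this(2)] A D obtain K1 K2 where
        K1: "\<And>H. H \<in> sets S \<Longrightarrow> H \<subseteq> D \<Longrightarrow> \<bar>\<mu> H\<bar> \<le> K1" and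
        K2: "\<And>H. H \<in> sets S \<Longrightarrow> H \<subseteq> A - D \<Longrightarrow> \<bar>\<mu> H\<bar> \<le> K2"
        by (metis sets.Diff)
      have "\<bar>\<mu> H\<bar> \<le> K1 + K2" if H: "H \<in> sets S" "H \<subseteq> A" for H
      proof -
        have "\<mu> H = \<mu> (H \<inter> D) + \<mu> (H - D)"
          using vector_measure_Un[OF vm, of "H \<inter> D" "H - D"] H D by (simp add: Int_Diff_Un Int_Diff_disjoint)
        moreover have "\<bar>\<mu> (H \<inter> D)\<bar> \<le> K1" using H D by (intro K1) auto
        moreover have "\<bar>\<mu> (H - D)\<bar> \<le> K2" using H D by (intro K2) auto
        ultimately show ?thesis by linarith
      qed
      moreover obtain H where "H \<in> sets S" "H \<subseteq> A" "K1 + K2 < \<bar>\<mu> H\<bar>"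
        using unbD[OF uA] by blast
      ultimately show False by (simp add: not_le[symmetric])
    qed
    then show ?thesis
    proof
      assume "unb D"
      then show ?thesis using D diff by (intro exI[of _ D]) auto
    next
      assume "unb (A - D)"
      moreover have "A - (A - D) = D" using D by auto
      ultimately show ?thesis using D by (intro exI[of _ "A - D"]) auto
    qed
  qed
  obtain A where A: "\<And>n::nat. unb (A n)" "\<And>n. A (Suc n) \<subseteq> A n \<and> 1 < \<bar>\<mu> (A n - A (Suc n))\<bar>"
    using dependent_nat_choice[of "\<lambda>_. unb" "\<lambda>_ A A'. A' \<subseteq> A \<and> 1 < \<bar>\<mu> (A - A')\<bar>"]
      unb_space step by metis
  have dec: "A n \<subseteq> A m" if "m \<le> n" for m n
    using lift_Suc_antimono_le[of A, OF _ that] A(2) by blast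
  have "disjoint_family (\<lambda>n. A n - A (Suc n))"
    unfolding disjoint_family_on_def
  proof (intro ballI impI)
    fix m n :: nat assume "m \<noteq> n"
    then consider "Suc m \<le> n" | "Suc n \<le> m" by linarith
    then show "(A m - A (Suc m)) \<inter> (A n - A (Suc n)) = {}"
      by cases (use dec in blast)+
  qed
  moreover have "range (\<lambda>n. A n - A (Suc n)) \<subseteq> sets S"
    using A(1) by (auto simp: unb_def)
  ultimately have "(\<lambda>n. \<mu> (A n - A (Suc n))) sums \<mu> (\<Union>n. A n - A (Suc n))"
    by (intro vector_measure_sums[OF vm])
  then have "(\<lambda>n. \<mu> (A n - A (Suc n))) \<longlonglongrightarrow> 0"
    using sums_summable summable_LIMSEQ_zero by blast
  then obtain n where "\<bar>\<mu> (A n - A (Suc n))\<bar> < 1"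
    using LIMSEQ_D[of _ 0 1] by fastforce
  then show False using A(2)[of n] by simp
qed

section \<open>Positive variation and Jordan decomposition\<close>

definition pos_var :: "'a measure \<Rightarrow> ('a set \<Rightarrow> real) \<Rightarrow> 'a set \<Rightarrow> real" where
  "pos_var S \<mu> A = (SUP D\<in>{D \<in> sets S. D \<subseteq> A}. \<mu> D)"

context
  fixes S :: "'a measure" and \<mu> :: "'a set \<Rightarrow> real"
  assumes vm: "vector_measure S \<mu>"
begin

lemma bdd_above_signed_measure: "bdd_above (\<mu> ` {D \<in> sets S. D \<subseteq> A})"
  using signed_measure_bounded[OF vm] by (fastforce intro: bdd_aboveI simp: abs_le_iff)

lemma pos_var_upper: "D \<in> sets S \<Longrightarrow> D \<subseteq> A \<Longrightarrow> \<mu> D \<le> pos_var S \<mu> A"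
  unfolding pos_var_def by (rule cSUP_upper[OF _ bdd_above_signed_measure]) auto

lemma pos_var_least:
  assumes "\<And>D. D \<in> sets S \<Longrightarrow> D \<subseteq> A \<Longrightarrow> \<mu> D \<le> b"
  shows "pos_var S \<mu> A \<le> b"
  unfolding pos_var_def using assms by (intro cSUP_least) auto

lemma pos_var_nonneg: "0 \<le> pos_var S \<mu> A"
  using pos_var_upper[of "{}" A] vector_measure_empty[OF vm] by simp

lemma pos_var_mono: "A \<subseteq> A' \<Longrightarrow> pos_var S \<mu> A \<le> pos_var S \<mu> A'"
  by (rule pos_var_least) (blast intro: pos_var_upper)

lemma pos_var_superadditive:
  assumes "A \<inter> A' = {}"
  shows "pos_var S \<mu> A + pos_var S \<mu> A' \<le> pos_var S \<mu> (A \<union> A')"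
proof -
  have *: "\<mu> D + \<mu> D' \<le> pos_var S \<mu> (A \<union> A')"
    if "D \<in> sets S" "D \<subseteq> A" "D' \<in> sets S" "D' \<subseteq> A'" for D D'
  proof -
    have "\<mu> D + \<mu> D' = \<mu> (D \<union> D')"
      using that assms by (intro vector_measure_Un[OF vm, symmetric]) auto
    also have "\<dots> \<le> pos_var S \<mu> (A \<union> A')"
      using that by (intro pos_var_upper) auto
    finally show ?thesis .
  qed
  have "pos_var S \<mu> A' \<le> pos_var S \<mu> (A \<union> A') - \<mu> D" if "D \<in> sets S" "D \<subseteq> A" for D
    using *[OF that] by (intro pos_var_least) (simp add: algebra_simps)
  then have "pos_var S \<mu> A \<le> pos_var S \<mu> (A \<union> A') - pos_var S \<mu> A'"
    by (intro pos_var_least) (simp add: algebra_simps)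
  then show ?thesis by simp
qed

text \<open>Superadditivity and monotonicity bound the partial sums. Conversely, a competitor
  \<open>D\<close> for the union is cut along the sets \<open>A n\<close>, and each piece competes
  for one term.\<close>

lemma pos_var_sums:
  assumes A: "range A \<subseteq> sets S" "disjoint_family A"
  shows "(\<lambda>n. pos_var S \<mu> (A n)) sums pos_var S \<mu> (\<Union>n::nat. A n)"
proof -
  have part: "(\<Sum>i<n. pos_var S \<mu> (A i)) \<le> pos_var S \<mu> (\<Union>i<n. A i)" for n
  proof (induction n)
    case 0
    show ?case using pos_var_nonneg by simp
  next
    case (Suc n)
    have "A i \<inter> A n = {}" if "i < n" for i
      using A(2) that by (simp add: disjoint_family_on_def)
    then have "(\<Union>i<n. A i) \<inter> A n = {}" by blast
    from pos_var_superadditive[OF this] Suc show ?case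
      by (simp add: lessThan_Suc Un_commute)
  qed
  have part': "(\<Sum>i<n. pos_var S \<mu> (A i)) \<le> pos_var S \<mu> (\<Union>n. A n)" for n
    using order_trans[OF part[of n] pos_var_mono[of "\<Union>i<n. A i" "\<Union>n. A n"]] by blast
  have summ: "summable (\<lambda>n. pos_var S \<mu> (A n))"
    by (rule summableI_nonneg_bounded[OF pos_var_nonneg part'])
  have "pos_var S \<mu> (\<Union>n. A n) \<le> (\<Sum>n. pos_var S \<mu> (A n))"
  proof (rule pos_var_least)
    fix D assume D: "D \<in> sets S" "D \<subseteq> (\<Union>n. A n)"
    have "range (\<lambda>n. D \<inter> A n) \<subseteq> sets S" "disjoint_family (\<lambda>n. D \<inter> A n)"
      using A D by (auto simp: disjoint_family_on_def)
    then have "(\<lambda>n. \<mu> (D \<inter> A n)) sums \<mu> (\<Union>n. D \<inter> A n)"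
      by (rule vector_measure_sums[OF vm])
    moreover have "(\<Union>n. D \<inter> A n) = D" using D by auto
    ultimately have sums: "(\<lambda>n. \<mu> (D \<inter> A n)) sums \<mu> D" by simp
    have "(\<Sum>n. \<mu> (D \<inter> A n)) \<le> (\<Sum>n. pos_var S \<mu> (A n))"
      using A D sums summ by (intro suminf_le pos_var_upper) (auto simp: sums_iff)
    then show "\<mu> D \<le> (\<Sum>n. pos_var S \<mu> (A n))"
      using sums by (simp add: sums_iff)
  qed
  moreover have "(\<Sum>n. pos_var S \<mu> (A n)) \<le> pos_var S \<mu> (\<Union>n. A n)"
    by (rule suminf_le_const[OF summ part'])
  ultimately show ?thesis
    using summ by (simp add: sums_iff)
qed

lemma space_jordan_pos [simp]: "space (jordan_pos S \<mu>) = space S"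
  and sets_jordan_pos [simp]: "sets (jordan_pos S \<mu>) = sets S"
  unfolding jordan_pos_def by (auto simp: space_measure_of_conv)

text \<open>In \<open>jordan_pos\<close> negative values are truncated before the supremum is taken,
  which is harmless because the empty set already contributes 0. Countable additivity of the
  positive variation then keeps \<open>measure_of\<close> from its default value.\<close>

lemma emeasure_jordan_pos:
  assumes "A \<in> sets S"
  shows "emeasure (jordan_pos S \<mu>) A = ennreal (pos_var S \<mu> A)"
proof -
  have eq: "(SUP D\<in>{D \<in> sets S. D \<subseteq> A}. ennreal (\<mu> D)) = ennreal (pos_var S \<mu> A)" for A
  proof (rule antisym)
    show "(SUP D\<in>{D \<in> sets S. D \<subseteq> A}. ennreal (\<mu> D)) \<le> ennreal (pos_var S \<mu> A)"
      by (intro SUP_least ennreal_leI pos_var_upper) auto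
    show "ennreal (pos_var S \<mu> A) \<le> (SUP D\<in>{D \<in> sets S. D \<subseteq> A}. ennreal (\<mu> D))"
    proof (cases "(SUP D\<in>{D \<in> sets S. D \<subseteq> A}. ennreal (\<mu> D))")
      case (real r)
      have "\<mu> D \<le> r" if "D \<in> sets S" "D \<subseteq> A" for D
      proof -
        have "ennreal (\<mu> D) \<le> ennreal r"
          unfolding real(2)[symmetric] using that by (intro SUP_upper) auto
        then show ?thesis using real(1) by (metis ennreal_le_iff)
      qed
      then show ?thesis
        using real by (auto intro!: ennreal_leI pos_var_least)
    next
      case top
      then show ?thesis by (simp only: top_greatest)
    qed
  qed
  have "jordan_pos S \<mu> = measure_of (space S) (sets S) (\<lambda>A. ennreal (pos_var S \<mu> A))"
    by (simp only: jordan_pos_def eq)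
  then show ?thesis
  proof (rule emeasure_measure_of)
    show "positive (sets (jordan_pos S \<mu>)) (\<lambda>A. ennreal (pos_var S \<mu> A))"
      using vector_measure_empty[OF vm] by (auto simp: positive_def pos_var_def)
    show "countably_additive (sets (jordan_pos S \<mu>)) (\<lambda>A. ennreal (pos_var S \<mu> A))"
      unfolding countably_additive_def
      by (auto intro!: sums_unique[symmetric] sums_ennreal[THEN iffD2] pos_var_sums pos_var_nonneg)
  qed (use assms sets.space_closed in auto)
qed

lemma measure_jordan_pos: "A \<in> sets S \<Longrightarrow> measure (jordan_pos S \<mu>) A = pos_var S \<mu> A"
  by (simp add: measure_def emeasure_jordan_pos pos_var_nonneg)

lemma finite_measure_jordan_pos: "finite_measure (jordan_pos S \<mu>)"
  by (rule finite_measureI) (simp add: emeasure_jordan_pos)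

end

text \<open>Passing from \<open>D\<close> to \<open>A - D\<close> turns competitors for
  \<open>\<mu>\<close> into competitors for \<open>- \<mu>\<close>, up to the constant
  \<open>\<mu> A\<close>; so the two variations on \<open>A\<close> differ by exactly that
  constant.\<close>

lemma jordan_decomposition:
  assumes vm: "vector_measure S \<mu>" and A: "A \<in> sets S"
  shows "\<mu> A = measure (jordan_pos S \<mu>) A - measure (jordan_pos S (\<lambda>A. - \<mu> A)) A"
proof -
  note vm' = vector_measure_uminus[OF vm]
  have "pos_var S \<mu> A \<le> \<mu> A + pos_var S (\<lambda>A. - \<mu> A) A"
  proof (rule pos_var_least[OF vm])
    fix D assume D: "D \<in> sets S" "D \<subseteq> A"
    then have "- \<mu> (A - D) \<le> pos_var S (\<lambda>A. - \<mu> A) A"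
      using A by (intro pos_var_upper[OF vm']) auto
    then show "\<mu> D \<le> \<mu> A + pos_var S (\<lambda>A. - \<mu> A) A"
      using vector_measure_Diff[OF vm A D] by simp
  qed
  moreover have "pos_var S (\<lambda>A. - \<mu> A) A \<le> pos_var S \<mu> A - \<mu> A"
  proof (rule pos_var_least[OF vm'])
    fix D assume D: "D \<in> sets S" "D \<subseteq> A"
    then have "\<mu> (A - D) \<le> pos_var S \<mu> A"
      using A by (intro pos_var_upper[OF vm]) auto
    then show "- \<mu> D \<le> pos_var S \<mu> A - \<mu> A"
      using vector_measure_Diff[OF vm A D] by simp
  qed
  ultimately show ?thesis
    using A by (simp add: measure_jordan_pos vm vm')
qed

text \<open>Integration of \<open>\<lfloor>n f\<rfloor> / n\<close>; this depends linearly on the values of \<open>\<mu>\<close>, which reduces all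
  identities between integrals to identities between set functions.\<close>

definition floor_sum ::
  "'a set \<Rightarrow> nat \<Rightarrow> ('a set \<Rightarrow> real) \<Rightarrow> ('a \<Rightarrow> real) \<Rightarrow> nat \<Rightarrow> real" where
  "floor_sum X K \<mu> f n =
     (\<Sum>j\<in>{- int (Suc n * K)..int (Suc n * K)}.
        real_of_int j / real (Suc n) * \<mu> {x \<in> X. \<lfloor>real (Suc n) * f x\<rfloor> = j})"

text \<open>\<open>floor_sum\<close> is the integral of the step function \<open>g n\<close>, which
  differs from \<open>f\<close> by at most \<open>1 / Suc n\<close>. The bound \<open>K\<close>
  confines its levels to the finite range of the sum, and \<open>Suc n\<close> avoids a division by
  zero.\<close>

lemma floor_sum_tendsto_integral:
  assumes "finite_measure M" and [measurable]: "f \<in> borel_measurable M"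
    and K: "\<And>x. x \<in> space M \<Longrightarrow> \<bar>f x\<bar> \<le> real K"
  shows "floor_sum (space M) K (measure M) f \<longlonglongrightarrow> (\<integral>x. f x \<partial>M)"
proof -
  interpret finite_measure M by fact
  define g where "g n x = real_of_int \<lfloor>real (Suc n) * f x\<rfloor> / real (Suc n)" for n x
  have [measurable]: "g n \<in> borel_measurable M" for n
    unfolding g_def by measurable
  have fl: "\<lfloor>real (Suc n) * f x\<rfloor> \<in> {- int (Suc n * K)..int (Suc n * K)}" if "x \<in> space M" for n x
  proof -
    have "\<bar>real (Suc n) * f x\<bar> \<le> real (Suc n) * real K"
      using K[OF that] by (simp add: abs_mult mult_left_mono del: of_nat_Suc)
    then have "- real (Suc n * K) \<le> real (Suc n) * f x" "real (Suc n) * f x \<le> real (Suc n * K)"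
      unfolding of_nat_mult by linarith+
    then show ?thesis
      unfolding atLeastAtMost_iff le_floor_iff floor_le_iff by linarith
  qed
  have g_close: "\<bar>g n x - f x\<bar> \<le> 1 / real (Suc n)" for n x
  proof -
    have "\<bar>real_of_int \<lfloor>real (Suc n) * f x\<rfloor> - real (Suc n) * f x\<bar> \<le> 1" by linarith
    moreover have "g n x - f x = (real_of_int \<lfloor>real (Suc n) * f x\<rfloor> - real (Suc n) * f x) / real (Suc n)"
      by (simp add: g_def field_simps)
    ultimately show ?thesis
      by (simp add: divide_right_mono del: of_nat_Suc)
  qed
  have int_f: "integrable M f"
    using K by (intro integrable_const_bound[of _ "real K"]) auto
  have g_bound: "\<bar>g n x\<bar> \<le> real K + 1" if "x \<in> space M" for n x
  proof -
    have "1 / real (Suc n) \<le> 1" by simp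
    then show ?thesis using g_close[of n x] K[OF that] by linarith
  qed
  have int_g: "integrable M (g n)" for n
    using g_bound by (intro integrable_const_bound[of _ "real K + 1"]) auto
  have eq: "floor_sum (space M) K (measure M) f n = (\<integral>x. g n x \<partial>M)" for n
  proof -
    define A where "A j = {x \<in> space M. \<lfloor>real (Suc n) * f x\<rfloor> = j}" for j
    have [measurable]: "A j \<in> sets M" for j
      unfolding A_def by measurable
    have [simp]: "integrable M (indicat_real (A j))" for j
      by (simp add: integrable_real_indicator less_top[symmetric])
    let ?J = "{- int (Suc n * K)..int (Suc n * K)}"
    have "(\<integral>x. g n x \<partial>M) = (\<integral>x. (\<Sum>j\<in>?J. real_of_int j / real (Suc n) * indicator (A j) x) \<partial>M)"
    proof (rule Bochner_Integration.integral_cong[OF refl])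
      fix x assume x: "x \<in> space M"
      have "(\<Sum>j\<in>?J. real_of_int j / real (Suc n) * indicator (A j) x) =
          (\<Sum>j\<in>?J. if j = \<lfloor>real (Suc n) * f x\<rfloor> then real_of_int j / real (Suc n) else 0)"
        using x by (intro sum.cong) (auto simp: A_def indicator_def)
      also have "\<dots> = g n x"
        using fl[OF x, of n] by (subst sum.delta) (auto simp: g_def)
      finally show "g n x = (\<Sum>j\<in>?J. real_of_int j / real (Suc n) * indicator (A j) x)" ..
    qed
    also have "\<dots> = (\<Sum>j\<in>?J. real_of_int j / real (Suc n) * measure M (A j))"
      by (subst Bochner_Integration.integral_sum) (simp_all del: times_divide_eq_left of_nat_Suc)
    finally show ?thesis by (simp add: floor_sum_def A_def)
  qed
  have close: "\<bar>(\<integral>x. g n x \<partial>M) - (\<integral>x. f x \<partial>M)\<bar> \<le> 1 / real (Suc n) * measure M (space M)" for n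
  proof -
    have "\<bar>(\<integral>x. g n x \<partial>M) - (\<integral>x. f x \<partial>M)\<bar> = \<bar>\<integral>x. g n x - f x \<partial>M\<bar>"
      using int_f int_g by simp
    also have "\<dots> \<le> (\<integral>x. \<bar>g n x - f x\<bar> \<partial>M)"
      by (rule integral_abs_bound)
    also have "\<dots> \<le> (\<integral>x. 1 / real (Suc n) \<partial>M)"
      using int_f int_g g_close by (intro integral_mono) auto
    finally show ?thesis by (simp add: mult.commute)
  qed
  have lim: "(\<lambda>n. 1 / real (Suc n) * measure M (space M)) \<longlonglongrightarrow> 0"
    using tendsto_mult_left_zero[OF LIMSEQ_inverse_real_of_nat, of "measure M (space M)"]
    by (simp only: inverse_eq_divide)
  have "(\<lambda>n. (\<integral>x. g n x \<partial>M) - (\<integral>x. f x \<partial>M)) \<longlonglongrightarrow> 0"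
    by (rule Lim_null_comparison[OF always_eventually lim]) (use close in \<open>simp only: real_norm_def, blast\<close>)
  then show ?thesis
    by (simp add: eq[abs_def] LIM_zero_iff)
qed

lemma floor_sum_cong:
  assumes "\<And>A. A \<in> sets S \<Longrightarrow> \<mu> A = \<mu>' A" and [measurable]: "f \<in> borel_measurable S"
  shows "floor_sum (space S) K \<mu> f n = floor_sum (space S) K \<mu>' f n"
  unfolding floor_sum_def by (intro sum.cong refl arg_cong2[of _ _ _ _ "(*)"] assms(1)) measurable

lemma floor_sum_lin:
  "floor_sum X K (\<lambda>A. t * \<mu> A + u * \<mu>' A) f n = t * floor_sum X K \<mu> f n + u * floor_sum X K \<mu>' f n"
  unfolding floor_sum_def
  by (simp add: sum_distrib_left sum.distrib[symmetric] algebra_simps)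

lemma floor_sum_tendsto_signed_integral:
  assumes vm: "vector_measure S \<mu>" and f: "f \<in> borel_measurable S"
    and K: "\<And>x. x \<in> space S \<Longrightarrow> \<bar>f x\<bar> \<le> real K"
  shows "floor_sum (space S) K \<mu> f \<longlonglongrightarrow> signed_integral S \<mu> f"
proof -
  let ?p = "jordan_pos S \<mu>" and ?n = "jordan_pos S (\<lambda>A. - \<mu> A)"
  note vm' = vector_measure_uminus[OF vm]
  have meas: "f \<in> borel_measurable ?p" "f \<in> borel_measurable ?n"
    using f by (simp_all add: measurable_cong_sets[OF sets_jordan_pos[OF vm] refl]
        measurable_cong_sets[OF sets_jordan_pos[OF vm'] refl])
  have "floor_sum (space S) K (measure ?p) f \<longlonglongrightarrow> (\<integral>x. f x \<partial>?p)"
    using floor_sum_tendsto_integral[OF finite_measure_jordan_pos[OF vm] meas(1)] K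
    by (simp add: space_jordan_pos[OF vm])
  moreover have "floor_sum (space S) K (measure ?n) f \<longlonglongrightarrow> (\<integral>x. f x \<partial>?n)"
    using floor_sum_tendsto_integral[OF finite_measure_jordan_pos[OF vm'] meas(2)] K
    by (simp add: space_jordan_pos[OF vm'])
  ultimately have "(\<lambda>n. floor_sum (space S) K (measure ?p) f n - floor_sum (space S) K (measure ?n) f n)
      \<longlonglongrightarrow> signed_integral S \<mu> f"
    unfolding signed_integral_def by (rule tendsto_diff)
  moreover have "floor_sum (space S) K \<mu> f =
      (\<lambda>n. floor_sum (space S) K (measure ?p) f n - floor_sum (space S) K (measure ?n) f n)"
  proof
    fix n
    show "floor_sum (space S) K \<mu> f n =
        floor_sum (space S) K (measure ?p) f n - floor_sum (space S) K (measure ?n) f n"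
    using floor_sum_cong[OF _ f, of \<mu> "\<lambda>A. 1 * measure ?p A + (- 1) * measure ?n A" K n]
      jordan_decomposition[OF vm] by (simp add: floor_sum_lin[of _ _ 1 _ "- 1", simplified])
  qed
  ultimately show ?thesis by simp
qed

text \<open>Floor sums see only the values of \<open>\<mu>\<close>, so every representation as a
  difference of finite measures computes the same integral. This admits images of
  \<open>Z\<^sup>+\<close> and \<open>Z\<^sup>-\<close>, which may overlap and then differ from the
  Jordan parts.\<close>

lemma signed_integral_eq_diff:
  assumes vm: "vector_measure S \<mu>" and f: "f \<in> borel_measurable S" "bounded (f ` space S)"
    and fin: "finite_measure \<alpha>" "finite_measure \<beta>" and sets: "sets \<alpha> = sets S" "sets \<beta> = sets S"
    and eq: "\<And>A. A \<in> sets S \<Longrightarrow> \<mu> A = measure \<alpha> A - measure \<beta> A"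
  shows "signed_integral S \<mu> f = (\<integral>x. f x \<partial>\<alpha>) - (\<integral>x. f x \<partial>\<beta>)"
proof -
  obtain K0 where "\<And>x. x \<in> space S \<Longrightarrow> \<bar>f x\<bar> \<le> K0"
    using f(2) by (auto simp: bounded_iff)
  then obtain K where K: "\<And>x. x \<in> space S \<Longrightarrow> \<bar>f x\<bar> \<le> real K"
    by (meson order_trans real_arch_simple)
  note sp = sets_eq_imp_space_eq[OF sets(1)] sets_eq_imp_space_eq[OF sets(2)]
  have meas: "f \<in> borel_measurable \<alpha>" "f \<in> borel_measurable \<beta>"
    using f(1) by (simp_all add: measurable_cong_sets[OF sets(1) refl] measurable_cong_sets[OF sets(2) refl])
  have "floor_sum (space S) K (measure \<alpha>) f \<longlonglongrightarrow> (\<integral>x. f x \<partial>\<alpha>)"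
    using floor_sum_tendsto_integral[OF fin(1) meas(1)] K by (simp add: sp)
  moreover have "floor_sum (space S) K (measure \<beta>) f \<longlonglongrightarrow> (\<integral>x. f x \<partial>\<beta>)"
    using floor_sum_tendsto_integral[OF fin(2) meas(2)] K by (simp add: sp)
  ultimately have "(\<lambda>n. floor_sum (space S) K (measure \<alpha>) f n - floor_sum (space S) K (measure \<beta>) f n)
      \<longlonglongrightarrow> (\<integral>x. f x \<partial>\<alpha>) - (\<integral>x. f x \<partial>\<beta>)"
    by (rule tendsto_diff)
  moreover have "floor_sum (space S) K \<mu> f =
      (\<lambda>n. floor_sum (space S) K (measure \<alpha>) f n - floor_sum (space S) K (measure \<beta>) f n)"
  proof
    fix n
    show "floor_sum (space S) K \<mu> f n =
        floor_sum (space S) K (measure \<alpha>) f n - floor_sum (space S) K (measure \<beta>) f n"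
    using floor_sum_cong[OF _ f(1), of \<mu> "\<lambda>A. 1 * measure \<alpha> A + (- 1) * measure \<beta> A" K n]
      eq by (simp add: floor_sum_lin[of _ _ 1 _ "- 1", simplified])
  qed
  ultimately have "floor_sum (space S) K \<mu> f \<longlonglongrightarrow> (\<integral>x. f x \<partial>\<alpha>) - (\<integral>x. f x \<partial>\<beta>)"
    by simp
  with floor_sum_tendsto_signed_integral[OF vm f(1) K] show ?thesis
    by (rule LIMSEQ_unique)
qed

text \<open>Jordan parts of a combination are in general not the combinations of the Jordan parts;
  linearity is read off the floor sums and survives the limit.\<close>

lemma signed_integral_lin_measure:
  assumes vm: "vector_measure S \<mu>" "vector_measure S \<mu>'"
    and f: "f \<in> borel_measurable S" "bounded (f ` space S)"
  shows "signed_integral S (\<lambda>A. t * \<mu> A + u * \<mu>' A) f =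
    t * signed_integral S \<mu> f + u * signed_integral S \<mu>' f"
proof -
  obtain K0 where "\<And>x. x \<in> space S \<Longrightarrow> \<bar>f x\<bar> \<le> K0"
    using f(2) by (auto simp: bounded_iff)
  then obtain K where K: "\<And>x. x \<in> space S \<Longrightarrow> \<bar>f x\<bar> \<le> real K"
    by (meson order_trans real_arch_simple)
  have "floor_sum (space S) K (\<lambda>A. t * \<mu> A + u * \<mu>' A) f \<longlonglongrightarrow>
      signed_integral S (\<lambda>A. t * \<mu> A + u * \<mu>' A) f"
    using vector_measure_lin[OF vm, of t u]
    by (intro floor_sum_tendsto_signed_integral f K) simp_all
  moreover have "floor_sum (space S) K (\<lambda>A. t * \<mu> A + u * \<mu>' A) f \<longlonglongrightarrow>
      t * signed_integral S \<mu> f + u * signed_integral S \<mu>' f"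
    unfolding floor_sum_lin
    by (intro tendsto_add tendsto_mult_left floor_sum_tendsto_signed_integral vm f K)
  ultimately show ?thesis by (rule LIMSEQ_unique)
qed

lemma signed_integral_lin:
  assumes vm: "vector_measure S \<mu>"
    and f: "f \<in> borel_measurable S" "bounded (f ` space S)"
    and g: "g \<in> borel_measurable S" "bounded (g ` space S)"
  shows "signed_integral S \<mu> (\<lambda>x. a * f x + b * g x) =
    a * signed_integral S \<mu> f + b * signed_integral S \<mu> g"
proof -
  have int: "integrable (jordan_pos S \<mu>) f"
    if vm: "vector_measure S \<mu>" and f: "f \<in> borel_measurable S" "bounded (f ` space S)" for \<mu> and f :: "'a \<Rightarrow> real"
  proof -
    obtain K where K: "\<And>x. x \<in> space S \<Longrightarrow> \<bar>f x\<bar> \<le> K"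
      using f(2) by (auto simp: bounded_iff)
    interpret finite_measure "jordan_pos S \<mu>" by (rule finite_measure_jordan_pos[OF vm])
    have "f \<in> borel_measurable (jordan_pos S \<mu>)"
      using f(1) by (simp add: measurable_cong_sets[OF sets_jordan_pos[OF vm] refl])
    then show ?thesis
      using K by (intro integrable_const_bound[of _ K]) (auto simp: space_jordan_pos[OF vm])
  qed
  note [simp] = int[OF vm f] int[OF vm g]
    int[OF vector_measure_uminus[OF vm] f] int[OF vector_measure_uminus[OF vm] g]
  show ?thesis
    unfolding signed_integral_def by (simp add: algebra_simps)
qed

section \<open>Restricted expectations\<close>

lemma vector_measure_cong:
  assumes "\<And>A. A \<in> sets S \<Longrightarrow> \<mu> A = \<mu>' A"
  shows "vector_measure S \<mu> \<longleftrightarrow> vector_measure S \<mu>'"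
proof -
  have "\<mu> (A n) = \<mu>' (A n)" "\<mu> (\<Union>n. A n) = \<mu>' (\<Union>n. A n)"
    if "range A \<subseteq> sets S" for A :: "nat \<Rightarrow> _" and n
    using assms that by (auto simp: sets.countable_UN)
  then show ?thesis
    unfolding vector_measure_def by (metis (no_types, lifting) sums_cong)
qed

lemma signed_integral_cong:
  assumes "\<And>A. A \<in> sets S \<Longrightarrow> \<mu> A = \<mu>' A"
  shows "signed_integral S \<mu> f = signed_integral S \<mu>' f"
proof -
  have "jordan_pos S \<mu> = jordan_pos S \<mu>'" "jordan_pos S (\<lambda>A. - \<mu> A) = jordan_pos S (\<lambda>A. - \<mu>' A)"
    unfolding jordan_pos_def using assms by (simp_all cong: SUP_cong_simp)
  then show ?thesis by (simp add: signed_integral_def)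
qed

lemma finite_measure_density_real:
  fixes Z :: "'a \<Rightarrow> real"
  assumes "integrable M Z"
  shows "finite_measure (density M (\<lambda>x. ennreal (Z x)))"
proof (rule finite_measureI)
  have [measurable]: "Z \<in> borel_measurable M" using assms by simp
  have "emeasure (density M (\<lambda>x. ennreal (Z x))) (space M) = (\<integral>\<^sup>+x. ennreal (Z x) \<partial>M)"
    by (auto simp: emeasure_density cong: nn_integral_cong)
  also have "\<dots> \<le> (\<integral>\<^sup>+x. ennreal (norm (Z x)) \<partial>M)"
    by (intro nn_integral_mono ennreal_leI) simp
  also have "\<dots> < \<infinity>"
    using assms by (simp add: integrable_iff_bounded)
  finally show "emeasure (density M (\<lambda>x. ennreal (Z x))) (space (density M (\<lambda>x. ennreal (Z x)))) \<noteq> \<infinity>"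
    by simp
qed

text \<open>For integrable \<open>Z\<close>, the set function \<open>A \<mapsto> E[Z; Y \<in> A]\<close> is the difference of the images under
  \<open>Y\<close> of the measures with densities \<open>Z\<^sup>+\<close> and \<open>Z\<^sup>-\<close>.\<close>

context
  fixes P :: "'w measure" and S :: "'a measure" and Y :: "'w \<Rightarrow> 'a"
  assumes finP: "finite_measure P" and Y [measurable]: "Y \<in> measurable P S"
begin

definition image_density :: "('w \<Rightarrow> real) \<Rightarrow> 'a measure" where
  "image_density Z = distr (density P (\<lambda>\<omega>. ennreal (max 0 (Z \<omega>)))) S Y"

lemma sets_image_density [simp]: "sets (image_density Z) = sets S"
  and space_image_density [simp]: "space (image_density Z) = space S"
  by (simp_all add: image_density_def)

lemma finite_measure_image_density:
  assumes "integrable P Z"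
  shows "finite_measure (image_density Z)"
proof -
  have "integrable P (\<lambda>\<omega>. max 0 (Z \<omega>))" using assms by simp
  then interpret finite_measure "density P (\<lambda>\<omega>. ennreal (max 0 (Z \<omega>)))"
    by (rule finite_measure_density_real)
  show ?thesis
    unfolding image_density_def by (rule finite_measure_distr) simp
qed

lemma integral_image_density:
  fixes f :: "'a \<Rightarrow> real"
  assumes Z: "Z \<in> borel_measurable P" and f [measurable]: "f \<in> borel_measurable S"
  shows "(\<integral>x. f x \<partial>image_density Z) = (\<integral>\<omega>. f (Y \<omega>) * max 0 (Z \<omega>) \<partial>P)"
proof -
  note [measurable] = Z
  have "(\<integral>x. f x \<partial>image_density Z) = (\<integral>\<omega>. f (Y \<omega>) \<partial>density P (\<lambda>\<omega>. ennreal (max 0 (Z \<omega>))))"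
    unfolding image_density_def by (rule integral_distr) simp_all
  also have "\<dots> = (\<integral>\<omega>. max 0 (Z \<omega>) *\<^sub>R f (Y \<omega>) \<partial>P)"
    by (rule integral_density) simp_all
  finally show ?thesis by (simp add: mult.commute)
qed

lemma measure_image_density:
  assumes "integrable P Z" and A: "A \<in> sets S"
  shows "measure (image_density Z) A = (\<integral>\<omega>. indicator A (Y \<omega>) * max 0 (Z \<omega>) \<partial>P)"
proof -
  interpret finite_measure "image_density Z"
    by (rule finite_measure_image_density) fact
  have "measure (image_density Z) A = (\<integral>x. indicator A x \<partial>image_density Z)"
    using A sets.sets_into_space by (simp add: Int_absorb2)
  also have "\<dots> = (\<integral>\<omega>. indicator A (Y \<omega>) * max 0 (Z \<omega>) \<partial>P)"
    using assms by (intro integral_image_density) auto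
  finally show ?thesis .
qed

lemma integrable_indicator_mult:
  fixes Z :: "'w \<Rightarrow> real"
  assumes "integrable P Z" and [measurable]: "A \<in> sets S"
  shows "integrable P (\<lambda>\<omega>. indicator A (Y \<omega>) * Z \<omega>)"
proof -
  have [measurable]: "Z \<in> borel_measurable P" using assms by simp
  show ?thesis
    by (rule Bochner_Integration.integrable_bound[OF assms(1)]) (auto simp: indicator_def)
qed

lemma restricted_expectation_eq_diff:
  fixes Z :: "'w \<Rightarrow> real"
  assumes Z: "integrable P Z" and A: "A \<in> sets S"
  shows "(\<integral>\<omega>. indicator A (Y \<omega>) * Z \<omega> \<partial>P) =
    measure (image_density Z) A - measure (image_density (\<lambda>\<omega>. - Z \<omega>)) A"
proof -
  have "integrable P (\<lambda>\<omega>. - Z \<omega>)" "integrable P (\<lambda>\<omega>. max 0 (Z \<omega>))" "integrable P (\<lambda>\<omega>. max 0 (- Z \<omega>))"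
    using Z by simp_all
  note int = this(1) this(2,3)[THEN integrable_indicator_mult[OF _ A]]
  have "(\<integral>\<omega>. indicator A (Y \<omega>) * Z \<omega> \<partial>P) =
      (\<integral>\<omega>. indicator A (Y \<omega>) * max 0 (Z \<omega>) - indicator A (Y \<omega>) * max 0 (- Z \<omega>) \<partial>P)"
    by (intro Bochner_Integration.integral_cong) (auto simp: max_def)
  then show ?thesis
    using Z A int by (simp add: measure_image_density)
qed

lemma vector_measure_restricted_expectation:
  fixes Z :: "'w \<Rightarrow> real"
  assumes Z: "integrable P Z"
  shows "vector_measure S (\<lambda>A. \<integral>\<omega>. indicator A (Y \<omega>) * Z \<omega> \<partial>P)"
proof -
  have "integrable P (\<lambda>\<omega>. - Z \<omega>)" using Z by simp
  note fin = finite_measure_image_density[OF Z] finite_measure_image_density[OF this]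
  have "vector_measure S (\<lambda>A. measure (image_density Z) A - measure (image_density (\<lambda>\<omega>. - Z \<omega>)) A)"
    unfolding vector_measure_def
    by (auto intro!: sums_diff finite_measure.finite_measure_UNION fin)
  then show ?thesis
    using vector_measure_cong[of S, OF restricted_expectation_eq_diff[OF Z]] by simp
qed

text \<open>Serves both measure components of the adjoint: the constant weight \<open>h\<close>
  yields the marginals, a coordinate of \<open>B\<close> yields the same coordinate of the moment
  measure.\<close>

lemma signed_integral_restricted_expectation:
  fixes Z :: "'w \<Rightarrow> real"
  assumes Z: "integrable P Z" and f: "f \<in> borel_measurable S" "bounded (f ` space S)"
  shows "signed_integral S (\<lambda>A. \<integral>\<omega>. indicator A (Y \<omega>) * Z \<omega> \<partial>P) f = (\<integral>\<omega>. f (Y \<omega>) * Z \<omega> \<partial>P)"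
proof -
  note [measurable] = f(1)
  have Z': "integrable P (\<lambda>\<omega>. - Z \<omega>)" using Z by simp
  obtain K where K: "\<And>x. x \<in> space S \<Longrightarrow> \<bar>f x\<bar> \<le> K"
    using f(2) by (auto simp: bounded_iff)
  have int: "integrable P (\<lambda>\<omega>. f (Y \<omega>) * max 0 (W \<omega>))" if W: "integrable P W" for W :: "'w \<Rightarrow> real"
  proof (rule Bochner_Integration.integrable_bound)
    have [measurable]: "W \<in> borel_measurable P" using W by simp
    show "integrable P (\<lambda>\<omega>. K * W \<omega>)" using W by simp
    show "(\<lambda>\<omega>. f (Y \<omega>) * max 0 (W \<omega>)) \<in> borel_measurable P" by measurable
    have "norm (f (Y \<omega>) * max 0 (W \<omega>)) \<le> norm (K * W \<omega>)" if "\<omega> \<in> space P" for \<omega>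
      using K[OF measurable_space[OF Y that]] by (auto simp: abs_mult intro!: mult_mono)
    then show "AE \<omega> in P. norm (f (Y \<omega>) * max 0 (W \<omega>)) \<le> norm (K * W \<omega>)" by simp
  qed
  have "signed_integral S (\<lambda>A. \<integral>\<omega>. indicator A (Y \<omega>) * Z \<omega> \<partial>P) f =
      (\<integral>x. f x \<partial>image_density Z) - (\<integral>x. f x \<partial>image_density (\<lambda>\<omega>. - Z \<omega>))"
    by (intro signed_integral_eq_diff vector_measure_restricted_expectation f Z Z'
        finite_measure_image_density restricted_expectation_eq_diff) simp_all
  also have "\<dots> = (\<integral>\<omega>. f (Y \<omega>) * max 0 (Z \<omega>) - f (Y \<omega>) * max 0 (- Z \<omega>) \<partial>P)"
    using Z Z' int[OF Z] int[OF Z'] by (simp add: integral_image_density)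
  also have "\<dots> = (\<integral>\<omega>. f (Y \<omega>) * Z \<omega> \<partial>P)"
    by (intro Bochner_Integration.integral_cong) (auto simp: max_def)
  finally show ?thesis .
qed

text \<open>A null set of the law of \<open>Y\<close> pulls back to a \<open>P\<close>-null set,
  over which the positive part of \<open>Z\<close> integrates to 0; hence absolute continuity.
  Finiteness of the measures makes the derivative real-valued.\<close>

lemma image_density_RN_deriv:
  assumes Z: "integrable P Z"
  shows "\<exists>g. integrable (distr P S Y) g \<and>
    (\<forall>A\<in>sets S. measure (image_density Z) A = (\<integral>x. indicator A x * g x \<partial>distr P S Y))"
proof -
  let ?\<nu> = "distr P S Y" and ?\<alpha> = "image_density Z"
  have [measurable]: "Z \<in> borel_measurable P" using Z by simp
  interpret finite_measure P by (rule finP)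
  interpret \<nu>: finite_measure ?\<nu> by (rule finite_measure_distr) simp
  interpret \<alpha>: finite_measure ?\<alpha> by (rule finite_measure_image_density[OF Z])
  have "emeasure ?\<alpha> A = 0" if A: "A \<in> sets S" "emeasure ?\<nu> A = 0" for A
  proof -
    have "emeasure P (Y -` A \<inter> space P) = 0"
      using A by (simp add: emeasure_distr)
    then have "AE \<omega> in P. \<omega> \<notin> Y -` A \<inter> space P"
      using A by (intro AE_I'[of "Y -` A \<inter> space P"]) (auto simp: null_sets_def)
    then have "(\<integral>\<^sup>+\<omega>. ennreal (max 0 (Z \<omega>)) * indicator (Y -` A \<inter> space P) \<omega> \<partial>P) = (\<integral>\<^sup>+\<omega>. 0 \<partial>P)"
      by (intro nn_integral_cong_AE) (auto simp: indicator_def)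
    then show ?thesis
      using A by (simp add: image_density_def emeasure_distr emeasure_density)
  qed
  then have ac: "absolutely_continuous ?\<nu> ?\<alpha>"
    unfolding absolutely_continuous_def null_sets_def by auto
  obtain D where D: "D \<in> borel_measurable ?\<nu>" "AE x in ?\<nu>. RN_deriv ?\<nu> ?\<alpha> x = ennreal (D x)"
    "\<And>x. 0 \<le> D x"
    by (rule \<nu>.real_RN_deriv[OF \<alpha>.finite_measure_axioms ac]) auto
  have em: "emeasure ?\<alpha> A = (\<integral>\<^sup>+x. ennreal (indicator A x * D x) \<partial>?\<nu>)" if A: "A \<in> sets S" for A
  proof -
    have "emeasure ?\<alpha> A = emeasure (density ?\<nu> (RN_deriv ?\<nu> ?\<alpha>)) A"
      using \<nu>.density_RN_deriv[OF ac] by simp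
    also have "\<dots> = (\<integral>\<^sup>+x. RN_deriv ?\<nu> ?\<alpha> x * indicator A x \<partial>?\<nu>)"
      using A by (intro emeasure_density) auto
    also have "\<dots> = (\<integral>\<^sup>+x. ennreal (indicator A x * D x) \<partial>?\<nu>)"
      using D(2) by (intro nn_integral_cong_AE) (auto simp: indicator_def)
    finally show ?thesis .
  qed
  have int: "integrable ?\<nu> (\<lambda>x. indicator A x * D x)" if A: "A \<in> sets S" for A
  proof (rule integrableI_nonneg)
    show "(\<lambda>x. indicator A x * D x) \<in> borel_measurable ?\<nu>" using D(1) A by simp
    show "(\<integral>\<^sup>+x. ennreal (indicator A x * D x) \<partial>?\<nu>) < \<infinity>"
      using em[OF A] \<alpha>.emeasure_finite[of A] by (simp add: less_top[symmetric])
  qed (use D(3) in simp)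
  have "integrable ?\<nu> D"
    using int[OF sets.top] by (rule Bochner_Integration.integrable_cong[OF refl, THEN iffD1, rotated]) simp
  moreover have "measure ?\<alpha> A = (\<integral>x. indicator A x * D x \<partial>?\<nu>)" if A: "A \<in> sets S" for A
    using int[OF A] D(3) A em[OF A] unfolding measure_def
    by (subst integral_eq_nn_integral) auto
  ultimately show ?thesis by blast
qed

lemma restricted_expectation_RN_deriv:
  fixes Z :: "'w \<Rightarrow> real"
  assumes Z: "integrable P Z"
  shows "\<exists>g. integrable (distr P S Y) g \<and>
    (\<forall>A\<in>sets S. (\<integral>\<omega>. indicator A (Y \<omega>) * Z \<omega> \<partial>P) = (\<integral>x. indicator A x * g x \<partial>distr P S Y))"
proof -
  have Z': "integrable P (\<lambda>\<omega>. - Z \<omega>)" using Z by simp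
  obtain f g where
    f: "integrable (distr P S Y) f"
      "\<forall>A\<in>sets S. measure (image_density Z) A = (\<integral>x. indicator A x * f x \<partial>distr P S Y)" and
    g: "integrable (distr P S Y) g"
      "\<forall>A\<in>sets S. measure (image_density (\<lambda>\<omega>. - Z \<omega>)) A = (\<integral>x. indicator A x * g x \<partial>distr P S Y)"
    using image_density_RN_deriv[OF Z] image_density_RN_deriv[OF Z'] by blast
  have int: "integrable (distr P S Y) (\<lambda>x. indicator A x * u x)"
    if "integrable (distr P S Y) u" "A \<in> sets S" for A and u :: "'a \<Rightarrow> real"
    using integrable_mult_indicator[of A "distr P S Y" u] that by simp
  have "(\<integral>\<omega>. indicator A (Y \<omega>) * Z \<omega> \<partial>P) = (\<integral>x. indicator A x * (f x - g x) \<partial>distr P S Y)"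
    if A: "A \<in> sets S" for A
    using restricted_expectation_eq_diff[OF Z A] f g A int[OF f(1) A] int[OF g(1) A]
    by (simp add: right_diff_distrib)
  then show ?thesis
    using f(1) g(1) by (intro exI[of _ "\<lambda>x. f x - g x"]) auto
qed

text \<open>\<open>cond_exp_given\<close> is chosen by \<open>SOME\<close>, so its defining property
  is available only once some density has been exhibited. One is assembled from the scalar densities
  of the coordinates.\<close>

lemma integral_cond_exp_given:
  fixes f :: "'w \<Rightarrow> real ^ 'k::finite"
  assumes f: "integrable P f" and A: "A \<in> sets S"
  shows "(LINT x:A|distr P S Y. cond_exp_given P S Y f x) = (\<integral>\<omega>. indicator A (Y \<omega>) *\<^sub>R f \<omega> \<partial>P)"
proof -
  let ?\<nu> = "distr P S Y" and ?m = "\<lambda>A. LINT \<omega>:(Y -` A \<inter> space P)|P. f \<omega>"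
  have m_eq: "?m A = (\<integral>\<omega>. indicator A (Y \<omega>) *\<^sub>R f \<omega> \<partial>P)" for A
    unfolding set_lebesgue_integral_def
    by (intro Bochner_Integration.integral_cong) (auto simp: indicator_def)
  have fj: "integrable P (\<lambda>\<omega>. f \<omega> $ j)" for j
    by (rule integrable_bounded_linear[OF bounded_linear_vec_nth f])
  have "\<forall>j. \<exists>g. integrable ?\<nu> g \<and>
      (\<forall>A\<in>sets S. (\<integral>\<omega>. indicator A (Y \<omega>) * f \<omega> $ j \<partial>P) = (\<integral>x. indicator A x * g x \<partial>?\<nu>))"
    using restricted_expectation_RN_deriv[OF fj] by blast
  then obtain g where g: "\<And>j. integrable ?\<nu> (g j)"
    "\<And>j A. A \<in> sets S \<Longrightarrow> (\<integral>\<omega>. indicator A (Y \<omega>) * f \<omega> $ j \<partial>P) = (\<integral>x. indicator A x * g j x \<partial>?\<nu>)"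
    by metis
  define G where "G x = (\<chi> j. g j x)" for x
  have G_eq: "G x = (\<Sum>j\<in>UNIV. g j x *\<^sub>R axis j 1)" for x
    by (simp add: G_def vec_eq_iff axis_def if_distrib sum.delta cong: if_cong)
  have G: "integrable ?\<nu> G"
    unfolding G_eq[abs_def] by (intro Bochner_Integration.integrable_sum integrable_scaleR_left) (simp add: g)
  have "?m A = (LINT x:A|?\<nu>. G x)" if A: "A \<in> sets ?\<nu>" for A
  proof -
    have A': "A \<in> sets S" using A by simp
    have [measurable]: "f \<in> borel_measurable P" using f by simp
    have i1: "integrable P (\<lambda>\<omega>. indicator A (Y \<omega>) *\<^sub>R f \<omega>)"
      by (rule Bochner_Integration.integrable_bound[OF f]) (use A' in \<open>auto simp: indicator_def\<close>)
    have i2: "integrable ?\<nu> (\<lambda>x. indicator A x *\<^sub>R G x)"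
      by (rule integrable_mult_indicator[OF A G])
    have "?m A $ j = (LINT x:A|?\<nu>. G x) $ j" for j
      using integral_bounded_linear[OF bounded_linear_vec_nth i1, of j]
        integral_bounded_linear[OF bounded_linear_vec_nth i2, of j] g(2)[OF A', of j]
      unfolding m_eq by (simp add: set_lebesgue_integral_def G_def)
    then show ?thesis by (simp add: vec_eq_iff)
  qed
  then have "\<exists>G. G \<in> borel_measurable ?\<nu> \<and> integrable ?\<nu> G \<and>
      (\<forall>A\<in>sets ?\<nu>. ?m A = (LINT x:A|?\<nu>. G x))"
    using G by (intro exI[of _ G]) auto
  from someI_ex[OF this] show ?thesis
    using A unfolding cond_exp_given_def vector_RN_deriv_def by (simp add: m_eq[symmetric])
qed

end

section \<open>Relative entropy\<close>

lemma ext_integral_integrable: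
  assumes "integrable M g"
  shows "ext_integral M (\<lambda>x. ereal (g x)) = ereal (\<integral>x. g x \<partial>M)"
proof -
  have fin: "(\<integral>\<^sup>+x. ennreal (g x) \<partial>M) \<noteq> \<infinity>" "(\<integral>\<^sup>+x. ennreal (- g x) \<partial>M) \<noteq> \<infinity>"
    using assms unfolding real_integrable_def by auto
  have *: "enn2ereal a = ereal (enn2real a)" if "a \<noteq> \<infinity>" for a
    using that by (cases a) auto
  show ?thesis
    unfolding ext_integral_def real_lebesgue_integral_def[OF assms]
    using fin by (simp add: e2ennreal_ereal *)
qed

text \<open>With a finite negative part, failure of integrability can only come from an infinite
  positive part. This settles entropies whose log-density is not integrable.\<close>

lemma ext_integral_not_integrable:
  assumes "g \<in> borel_measurable M" "\<not> integrable M g" "(\<integral>\<^sup>+x. ennreal (- g x) \<partial>M) < \<infinity>"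
  shows "ext_integral M (\<lambda>x. ereal (g x)) = \<infinity>"
proof -
  have "(\<integral>\<^sup>+x. ennreal (g x) \<partial>M) = \<infinity>"
    using assms unfolding real_integrable_def by auto
  moreover obtain r where "(\<integral>\<^sup>+x. ennreal (- g x) \<partial>M) = ennreal r" "0 \<le> r"
    using assms(3) by (cases "\<integral>\<^sup>+x. ennreal (- g x) \<partial>M") auto
  ultimately show ?thesis
    unfolding ext_integral_def by (simp add: e2ennreal_ereal)
qed

lemma ext_integral_cong_AE:
  assumes "AE x in M. f x = g x"
  shows "ext_integral M f = ext_integral M g"
proof -
  have "(\<integral>\<^sup>+x. e2ennreal (f x) \<partial>M) = (\<integral>\<^sup>+x. e2ennreal (g x) \<partial>M)"
    "(\<integral>\<^sup>+x. e2ennreal (- f x) \<partial>M) = (\<integral>\<^sup>+x. e2ennreal (- g x) \<partial>M)"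
    by (intro nn_integral_cong_AE; use assms in auto)+
  then show ?thesis by (simp add: ext_integral_def)
qed

text \<open>Follows from \<open>ln y \<le> y - 1\<close> at \<open>y = 1 / x\<close>. Integrated
  over \<open>Q\<close> with \<open>x = D\<close>, it bounds the negative part of
  \<open>ln D - 1\<close> under \<open>P\<close> by the mass of \<open>Q\<close>, so the entropy is
  never an indeterminate difference of infinities.\<close>

lemma mult_one_minus_ln_le_one:
  fixes x :: real
  assumes "0 \<le> x"
  shows "x * (1 - ln x) \<le> 1"
proof (cases "x = 0")
  case False
  then have "0 < x" using assms by simp
  have "ln (1 / x) \<le> 1 / x - 1"
    using \<open>0 < x\<close> by (intro ln_le_minus_one) simp
  then have "1 - ln x \<le> 1 / x"
    using \<open>0 < x\<close> by (simp add: ln_div)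
  then have "x * (1 - ln x) \<le> x * (1 / x)"
    using \<open>0 < x\<close> by (intro mult_left_mono) auto
  then show ?thesis using \<open>0 < x\<close> by simp
qed simp

section \<open>Entropy compared with a bounded exponential density\<close>

context
  fixes Q :: "'a measure" and u :: "'a \<Rightarrow> real" and K :: real and R
  assumes finQ: "finite_measure Q" and u [measurable]: "u \<in> borel_measurable Q"
    and u_bound: "\<forall>x\<in>space Q. \<bar>u x\<bar> \<le> K"
    and R_def: "R = density Q (\<lambda>x. ennreal (exp (u x)))" and probR: "prob_space R"
begin

interpretation Q: finite_measure Q by (rule finQ)

interpretation R: prob_space R by (rule probR)

lemma integrable_u:
  assumes "prob_space P" and sets: "sets P = sets Q"
  shows "integrable P u"
proof -
  interpret P: prob_space P by fact
  have "u \<in> borel_measurable P"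
    using u by (simp add: measurable_cong_sets[OF sets refl])
  then show ?thesis
    using u_bound sets_eq_imp_space_eq[OF sets] by (intro P.integrable_const_bound[of _ K]) auto
qed

lemma KL_exp_density: "KL R Q = ereal ((\<integral>x. u x \<partial>R) - 1)"
proof -
  have sets: "sets R = sets Q" by (simp add: R_def)
  have ac: "absolutely_continuous Q R"
    unfolding R_def by (rule absolutely_continuousI_density) simp
  have "AE x in Q. ennreal (exp (u x)) = RN_deriv Q R x"
    by (rule Q.RN_deriv_unique) (simp_all add: R_def)
  then have "AE x in R. ennreal (exp (u x)) = RN_deriv Q R x"
    by (rule absolutely_continuous_AE[OF sets ac])
  then have "AE x in R. ereal (ln (enn2real (RN_deriv Q R x)) - 1) = ereal (u x - 1)"
    by (auto elim!: eventually_mono) (metis enn2real_ennreal exp_ge_zero ln_exp)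
  from ext_integral_cong_AE[OF this] have "KL R Q = ext_integral R (\<lambda>x. ereal (u x - 1))"
    using ac by (simp add: KL_def)
  also have "\<dots> = ereal (\<integral>x. u x - 1 \<partial>R)"
    using integrable_u[OF probR sets] by (intro ext_integral_integrable) auto
  also have "\<dots> = ereal ((\<integral>x. u x \<partial>R) - 1)"
    using integrable_u[OF probR sets] by (simp add: R.prob_space)
  finally show ?thesis .
qed

text \<open>By the chain rule \<open>ln dP/dQ = ln dP/dR + u\<close>, so \<open>KL P Q\<close>
  exceeds the bound by the classical divergence of \<open>P\<close> from \<open>R\<close>. Its
  nonnegativity and its case of equality give the two claims.\<close>

lemma KL_exp_density_lower:
  assumes probP: "prob_space P" and sets: "sets P = sets Q"
  shows "ereal ((\<integral>x. u x \<partial>P) - 1) \<le> KL P Q"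
    and "KL P Q = ereal ((\<integral>x. u x \<partial>P) - 1) \<Longrightarrow> P = R"
proof -
  interpret P: prob_space P by (rule probP)
  note intu = integrable_u[OF probP sets]
  have "ereal ((\<integral>x. u x \<partial>P) - 1) \<le> KL P Q \<and> (KL P Q = ereal ((\<integral>x. u x \<partial>P) - 1) \<longrightarrow> P = R)"
  proof (cases "absolutely_continuous Q P")
    case False
    then show ?thesis by (simp add: KL_def)
  next
    case ac: True
    obtain D where D [measurable]: "D \<in> borel_measurable Q"
      and RN: "AE x in Q. RN_deriv Q P x = ennreal (D x)"
      and pos: "AE x in P. 0 < D x" and nonneg: "\<And>x. 0 \<le> D x"
      by (rule Q.real_RN_deriv[OF P.finite_measure_axioms ac sets]) auto
    have P_eq: "P = density Q (\<lambda>x. ennreal (D x))"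
      using Q.density_RN_deriv[OF ac sets] RN by (metis borel_measurable_RN_deriv D density_cong measurable_compose measurable_ennreal)
    have D_P [measurable]: "D \<in> borel_measurable P" and u_P [measurable]: "u \<in> borel_measurable P"
      using D u by (simp_all add: measurable_cong_sets[OF sets refl])
    define g where "g x = ln (D x) - 1" for x
    have g_P [measurable]: "g \<in> borel_measurable P"
      unfolding g_def by measurable
    have "AE x in P. ereal (ln (enn2real (RN_deriv Q P x)) - 1) = ereal (g x)"
      using absolutely_continuous_AE[OF sets ac RN]
      by (rule eventually_mono) (simp add: g_def nonneg)
    from ext_integral_cong_AE[OF this] have KL_eq: "KL P Q = ext_integral P (\<lambda>x. ereal (g x))"
      using ac by (simp add: KL_def)
    have "(\<integral>\<^sup>+x. ennreal (- g x) \<partial>P) = (\<integral>\<^sup>+x. ennreal (D x) * ennreal (1 - ln (D x)) \<partial>Q)"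
      unfolding P_eq g_def by (subst nn_integral_density) auto
    also have "\<dots> \<le> (\<integral>\<^sup>+x. 1 \<partial>Q)"
    proof (intro nn_integral_mono)
      fix x
      show "ennreal (D x) * ennreal (1 - ln (D x)) \<le> 1"
        using mult_one_minus_ln_le_one[OF nonneg[of x]] nonneg[of x]
        by (simp add: ennreal_mult'[symmetric] ennreal_le_1)
    qed
    also have "\<dots> < \<infinity>"
      by (simp add: less_top[symmetric])
    finally have neg: "(\<integral>\<^sup>+x. ennreal (- g x) \<partial>P) < \<infinity>" .
    show ?thesis
    \<comment> \<open>The negative part being finite, a nonintegrable \<open>g\<close> means
      infinite entropy, and both claims are immediate.\<close>
    proof (cases "integrable P g")
      case False
      from ext_integral_not_integrable[OF g_P this neg] show ?thesis
        by (simp add: KL_eq)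
    next
      case intg: True
      \<comment> \<open>The density of \<open>P\<close> with respect to \<open>R\<close>, obtained
        by dividing out \<open>exp u\<close>.\<close>
      define D' where "D' x = D x * exp (- u x)" for x
      have D' [measurable]: "D' \<in> borel_measurable R"
        unfolding D'_def R_def by simp
      have D'_nonneg: "0 \<le> D' x" for x using nonneg by (simp add: D'_def)
      have P_eq': "density R (\<lambda>x. ennreal (D' x)) = P"
        unfolding R_def P_eq D'_def
        by (subst density_density_eq)
          (auto simp: ennreal_mult'[symmetric] exp_minus field_simps nonneg intro!: density_cong)
      \<comment> \<open>Only almost everywhere under \<open>P\<close>: splitting the logarithm needs
        \<open>0 < D x\<close>, which may fail where \<open>Q\<close> has mass and \<open>P\<close>
        has none.\<close>
      have lnD': "AE x in P. ln (D' x) = g x + 1 - u x"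
        using pos by (rule eventually_mono) (simp add: D'_def g_def ln_mult)
      have lnD'_P: "(\<lambda>x. ln (D' x)) \<in> borel_measurable P"
        unfolding D'_def by measurable
      have int_lnD': "integrable P (\<lambda>x. ln (D' x))"
        using lnD' by (subst integrable_cong_AE[OF lnD'_P _ lnD']) (use intg intu in auto)
      \<comment> \<open>\<open>KL_divergence\<close> carries the base of its logarithm as a
        parameter; base \<open>exp 1\<close> makes it the natural one.\<close>
      have log_exp: "log (exp 1) y = ln y" for y by (simp add: log_def)
      interpret I: information_space R "exp 1" by unfold_locales simp
      have int_R: "integrable R (\<lambda>x. D' x * log (exp 1) (D' x))"
        using int_lnD' D'_nonneg unfolding P_eq'[symmetric] log_exp
        by (subst (asm) integrable_density) auto
      have probD': "prob_space (density R (\<lambda>x. ennreal (D' x)))"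
        using probP by (simp add: P_eq')
      have "KL_divergence (exp 1) R (density R (\<lambda>x. ennreal (D' x))) = (\<integral>x. D' x * ln (D' x) \<partial>R)"
        using R.KL_density[of "exp 1" D'] D'_nonneg by (simp add: log_exp)
      also have "\<dots> = (\<integral>x. ln (D' x) \<partial>P)"
        unfolding P_eq'[symmetric] using D'_nonneg by (subst integral_density) auto
      also have "\<dots> = (\<integral>x. g x + 1 - u x \<partial>P)"
        by (rule integral_cong_AE) (use lnD'_P lnD' in auto)
      also have "\<dots> = (\<integral>x. g x \<partial>P) + 1 - (\<integral>x. u x \<partial>P)"
        using intg intu by (simp add: P.prob_space)
      finally have eq: "KL_divergence (exp 1) R (density R (\<lambda>x. ennreal (D' x))) =
        (\<integral>x. g x \<partial>P) + 1 - (\<integral>x. u x \<partial>P)" .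
      have "0 \<le> (\<integral>x. g x \<partial>P) + 1 - (\<integral>x. u x \<partial>P)"
        using I.KL_nonneg[OF probD' D' _ int_R] D'_nonneg eq by simp
      moreover have "P = R" if "(\<integral>x. g x \<partial>P) + 1 - (\<integral>x. u x \<partial>P) = 0"
        using I.KL_eq_0_iff_eq[OF probD' D' _ int_R] D'_nonneg eq that P_eq' by simp
      ultimately show ?thesis
        unfolding KL_eq ext_integral_integrable[OF intg] by auto
    qed
  qed
  then show "ereal ((\<integral>x. u x \<partial>P) - 1) \<le> KL P Q"
    and "KL P Q = ereal ((\<integral>x. u x \<partial>P) - 1) \<Longrightarrow> P = R" by blast+
qed

end

section \<open>The duality of test functions and measures\<close>

text \<open>A supremum of affine functions is convex. Real upper bounds \<open>a\<close> and
  \<open>b\<close> stand in for the values of the conjugate, which avoids extended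
  arithmetic.\<close>

lemma (in weak_duality) conj_convex:
  assumes proper: "proper_on S f" and "\<Phi> \<in> E" "\<Psi> \<in> E" "0 \<le> t" "t \<le> 1"
    and "conj f \<Phi> \<le> ereal a" "conj f \<Psi> \<le> ereal b"
  shows "conj f (lin (1 - t) \<Phi> t \<Psi>) \<le> ereal ((1 - t) * a + t * b)"
  unfolding conj_le_iff[OF proper]
proof (intro ballI allI impI)
  fix \<xi> r assume \<xi>: "\<xi> \<in> S" "f \<xi> = ereal r"
  then have "p \<Phi> \<xi> - r \<le> a" "p \<Psi> \<xi> - r \<le> b"
    using assms unfolding conj_le_iff[OF proper] by blast+
  then have "(1 - t) * (p \<Phi> \<xi> - r) + t * (p \<Psi> \<xi> - r) \<le> (1 - t) * a + t * b"
    using assms by (intro add_mono mult_left_mono) auto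
  then show "p (lin (1 - t) \<Phi> t \<Psi>) \<xi> - r \<le> (1 - t) * a + t * b"
    using pair_lin[OF assms(2,3) \<xi>(1)] by (simp add: algebra_simps)
qed

lemma vector_measure_componentwise:
  fixes m :: "'a set \<Rightarrow> real ^ 'k::finite"
  assumes "\<And>j. vector_measure S (\<lambda>A. m A $ j)"
  shows "vector_measure S m"
  using assms unfolding vector_measure_def sums_def by (auto intro!: vec_tendstoI)

lemma bcont_on_lin:
  fixes f g :: "'a::topological_space \<Rightarrow> 'b::real_normed_vector"
  assumes "bcont_on S f" "bcont_on S g"
  shows "bcont_on S (\<lambda>x. a *\<^sub>R f x + b *\<^sub>R g x)"
  using assms unfolding bcont_on_def
  by (auto intro!: continuous_intros bounded_plus_comp bounded_scaleR_comp)

lemma bcont_on_component: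
  fixes f :: "'a::topological_space \<Rightarrow> real ^ 'k::finite"
  assumes "bcont_on S f"
  shows "bcont_on S (\<lambda>x. f x $ j)"
  using assms bounded_linear_image[OF _ bounded_linear_vec_nth, of "f ` S" j]
  unfolding bcont_on_def by (auto intro!: continuous_intros simp: image_image)

lemma space_state_space [simp]: "space (state_space X k) = X k"
  by (simp add: state_space_def space_restrict_space)

lemma bcont_on_state_space:
  fixes f :: "real \<Rightarrow> real"
  assumes "bcont_on (X k) f"
  shows "f \<in> borel_measurable (state_space X k)" "bounded (f ` space (state_space X k))"
  using assms by (auto simp: bcont_on_def state_space_def space_restrict_space
      intro: borel_measurable_continuous_on_restrict)

fun test_lin :: "real \<Rightarrow> ('k::finite, 'i) test \<Rightarrow> real \<Rightarrow> ('k, 'i) test \<Rightarrow> ('k, 'i) test" where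
  "test_lin a (\<phi>, \<psi>, \<Lambda>) b (\<phi>', \<psi>', \<Lambda>') =
     (\<lambda>k x. a * \<phi> k x + b * \<phi>' k x, \<lambda>k x. a *\<^sub>R \<psi> k x + b *\<^sub>R \<psi>' k x, \<lambda>k i. a * \<Lambda> k i + b * \<Lambda>' k i)"

lemma test_lin_mem:
  assumes "\<Phi> \<in> test_space N X" "\<Psi> \<in> test_space N X"
  shows "test_lin a \<Phi> b \<Psi> \<in> test_space N X"
proof -
  have "bcont_on S (\<lambda>x. a * f x + b * g x)" if "bcont_on S f" "bcont_on S g"
    for S :: "real set" and f g :: "real \<Rightarrow> real"
    using bcont_on_lin[OF that] by simp
  then show ?thesis
    using assms by (cases \<Phi>; cases \<Psi>) (auto simp: test_space_def bcont_on_lin)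
qed

text \<open>The dual objective negates triples by the pointwise minus of their type; this brings it
  under the linearity lemmas for \<open>test_lin\<close>.\<close>

lemma uminus_test: "- \<Phi> = test_lin (- 1) \<Phi> 0 \<Phi>"
  by (cases \<Phi>) (auto simp: fun_eq_iff)

lemma uminus_test_lin: "- test_lin a \<Phi> b \<Psi> = test_lin a (- \<Phi>) b (- \<Psi>)"
  by (cases \<Phi>; cases \<Psi>) (auto simp: fun_eq_iff)

lemma uminus_test_mem: "\<Phi> \<in> test_space N X \<Longrightarrow> - \<Phi> \<in> test_space N X"
  unfolding uminus_test by (rule test_lin_mem)

lemma dual_comb_mem:
  assumes "\<xi> \<in> dual_space N X" "\<eta> \<in> dual_space N X"
  shows "dual_comb t \<xi> \<eta> \<in> dual_space N X"
proof -
  have "vector_measure S (\<lambda>A. t * \<mu> A + (1 - t) * \<mu>' A)"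
    if "vector_measure S \<mu>" "vector_measure S \<mu>'" for S :: "real measure" and \<mu> \<mu>' :: "real set \<Rightarrow> real"
    using vector_measure_lin[OF that] by simp
  then show ?thesis
    using assms by (cases \<xi>; cases \<eta>) (auto simp: dual_space_def vector_measure_lin)
qed

lemma vector_integral_lin:
  fixes f g :: "real \<Rightarrow> real ^ 'k::finite"
  assumes "vector_measure (state_space X k) m" "bcont_on (X k) f" "bcont_on (X k) g"
  shows "vector_integral (state_space X k) m (\<lambda>x. a *\<^sub>R f x + b *\<^sub>R g x) =
    a * vector_integral (state_space X k) m f + b * vector_integral (state_space X k) m g"
proof -
  have "signed_integral (state_space X k) (\<lambda>A. m A $ j) (\<lambda>x. a * f x $ j + b * g x $ j) =
      a * signed_integral (state_space X k) (\<lambda>A. m A $ j) (\<lambda>x. f x $ j) +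
      b * signed_integral (state_space X k) (\<lambda>A. m A $ j) (\<lambda>x. g x $ j)" for j
    by (intro signed_integral_lin vector_measure_component bcont_on_state_space bcont_on_component assms)
  then show ?thesis
    by (simp add: vector_integral_def sum.distrib sum_distrib_left)
qed

lemma vector_integral_lin_measure:
  fixes f :: "real \<Rightarrow> real ^ 'k::finite"
  assumes "vector_measure (state_space X k) m" "vector_measure (state_space X k) m'" "bcont_on (X k) f"
  shows "vector_integral (state_space X k) (\<lambda>A. t *\<^sub>R m A + u *\<^sub>R m' A) f =
    t * vector_integral (state_space X k) m f + u * vector_integral (state_space X k) m' f"
proof -
  have "signed_integral (state_space X k) (\<lambda>A. t * m A $ j + u * m' A $ j) (\<lambda>x. f x $ j) =
      t * signed_integral (state_space X k) (\<lambda>A. m A $ j) (\<lambda>x. f x $ j) +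
      u * signed_integral (state_space X k) (\<lambda>A. m' A $ j) (\<lambda>x. f x $ j)" for j
    by (intro signed_integral_lin_measure vector_measure_component bcont_on_state_space
        bcont_on_component assms)
  then show ?thesis
    by (simp add: vector_integral_def sum.distrib sum_distrib_left)
qed

lemma pairing_test_lin:
  assumes "\<Phi> \<in> test_space N X" "\<Psi> \<in> test_space N X" "\<xi> \<in> dual_space N X"
  shows "pairing N X I (test_lin a \<Phi> b \<Psi>) \<xi> = a * pairing N X I \<Phi> \<xi> + b * pairing N X I \<Psi> \<xi>"
proof -
  obtain \<phi> \<psi> \<Lambda> \<phi>' \<psi>' \<Lambda>' u v g where
    eq: "\<Phi> = (\<phi>, \<psi>, \<Lambda>)" "\<Psi> = (\<phi>', \<psi>', \<Lambda>')" "\<xi> = (u, v, g)" by (metis prod_cases3)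
  have "signed_integral (state_space X k) (u k) (\<lambda>x. a * \<phi> k x + b * \<phi>' k x) =
      a * signed_integral (state_space X k) (u k) (\<phi> k) + b * signed_integral (state_space X k) (u k) (\<phi>' k)"
    "vector_integral (state_space X k) (v k) (\<lambda>x. a *\<^sub>R \<psi> k x + b *\<^sub>R \<psi>' k x) =
      a * vector_integral (state_space X k) (v k) (\<psi> k) + b * vector_integral (state_space X k) (v k) (\<psi>' k)"
    if "k < N" for k
    using assms that unfolding eq
    by (auto simp: test_space_def dual_space_def
        intro!: signed_integral_lin bcont_on_state_space vector_integral_lin)
  then show ?thesis
    unfolding eq by (simp add: sum_distrib_left sum.distrib algebra_simps)
qed

lemma pairing_dual_comb:
  assumes "\<Phi> \<in> test_space N X" "\<xi> \<in> dual_space N X" "\<eta> \<in> dual_space N X"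
  shows "pairing N X I \<Phi> (dual_comb t \<xi> \<eta>) = t * pairing N X I \<Phi> \<xi> + (1 - t) * pairing N X I \<Phi> \<eta>"
proof -
  obtain \<phi> \<psi> \<Lambda> u v g u' v' g' where
    eq: "\<Phi> = (\<phi>, \<psi>, \<Lambda>)" "\<xi> = (u, v, g)" "\<eta> = (u', v', g')" by (metis prod_cases3)
  have s: "signed_integral (state_space X k) (\<lambda>A. t * u k A + (1 - t) * u' k A) (\<phi> k) =
      t * signed_integral (state_space X k) (u k) (\<phi> k) + (1 - t) * signed_integral (state_space X k) (u' k) (\<phi> k)"
    and v: "vector_integral (state_space X k) (\<lambda>A. t *\<^sub>R v k A + (1 - t) *\<^sub>R v' k A) (\<psi> k) =
      t * vector_integral (state_space X k) (v k) (\<psi> k) + (1 - t) * vector_integral (state_space X k) (v' k) (\<psi> k)"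
    if "k < N" for k
    using assms that unfolding eq
    by (auto simp: test_space_def dual_space_def
        intro!: signed_integral_lin_measure bcont_on_state_space vector_integral_lin_measure)
  have l: "(\<Sum>i\<in>I k. \<Lambda> k i * (t * g k i + (1 - t) * g' k i)) =
      t * (\<Sum>i\<in>I k. \<Lambda> k i * g k i) + (1 - t) * (\<Sum>i\<in>I k. \<Lambda> k i * g' k i)" for k
    unfolding sum_distrib_left sum.distrib[symmetric] by (intro sum.cong) (auto simp: algebra_simps)
  show ?thesis
    unfolding eq dual_comb.simps pairing.simps sum_distrib_left sum.distrib[symmetric]
    by (intro sum.cong refl) (simp only: s v l lessThan_iff, simp only: distrib_left add_ac)
qed

lemma weak_duality_pairing:
  "weak_duality (test_space N X) (dual_space N X) (pairing N X I) test_lin dual_comb"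
proof
  have "(\<lambda>_ _. 0, \<lambda>_ _. 0, \<lambda>_ _. 0) \<in> test_space N X"
    by (auto simp: test_space_def bcont_on_def image_constant_conv)
  then show "test_space N X \<noteq> {}" by blast
qed (auto intro: test_lin_mem dual_comb_mem pairing_test_lin pairing_dual_comb simp del: pairing.simps)

lemma Delta_test_lin:
  "Delta h N B I G (test_lin a \<Phi> b \<Psi>) x = a * Delta h N B I G \<Phi> x + b * Delta h N B I G \<Psi> x"
proof -
  obtain \<phi> \<psi> \<Lambda> \<phi>' \<psi>' \<Lambda>' where eq: "\<Phi> = (\<phi>, \<psi>, \<Lambda>)" "\<Psi> = (\<phi>', \<psi>', \<Lambda>')" by (metis prod_cases3)
  have l: "(\<Sum>i\<in>I k. (a * \<Lambda> k i + b * \<Lambda>' k i) * G i (x k)) =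
      a * (\<Sum>i\<in>I k. \<Lambda> k i * G i (x k)) + b * (\<Sum>i\<in>I k. \<Lambda>' k i * G i (x k))" for k
    unfolding sum_distrib_left sum.distrib[symmetric] by (intro sum.cong) (auto simp: algebra_simps)
  have "h * (a * \<phi> k (x k) + b * \<phi>' k (x k)) + (a *\<^sub>R \<psi> k (x k) + b *\<^sub>R \<psi>' k (x k)) \<bullet> B (x k) (x (Suc k)) +
      (\<Sum>i\<in>I k. (a * \<Lambda> k i + b * \<Lambda>' k i) * G i (x k)) =
      a * (h * \<phi> k (x k) + \<psi> k (x k) \<bullet> B (x k) (x (Suc k)) + (\<Sum>i\<in>I k. \<Lambda> k i * G i (x k))) +
      b * (h * \<phi>' k (x k) + \<psi>' k (x k) \<bullet> B (x k) (x (Suc k)) + (\<Sum>i\<in>I k. \<Lambda>' k i * G i (x k)))" for k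
    unfolding l by (simp add: inner_add_left algebra_simps)
  then show ?thesis
    unfolding eq test_lin.simps Delta.simps by (simp only: sum.distrib sum_distrib_left[symmetric])
qed

section \<open>Path measures\<close>

text \<open>A class closed under sums, products and \<open>exp\<close> whose members are integrable
  for every finite measure on the path space at once: the reference measure, the induced one and all
  competitors.\<close>

definition bounded_measurable :: "'a measure \<Rightarrow> ('a \<Rightarrow> real) \<Rightarrow> bool" where
  "bounded_measurable M f \<longleftrightarrow> f \<in> borel_measurable M \<and> (\<exists>K. \<forall>x\<in>space M. \<bar>f x\<bar> \<le> K)"

lemma bounded_measurable_const: "bounded_measurable M (\<lambda>_. c)"
  by (auto simp: bounded_measurable_def)

lemma bounded_measurable_add:
  assumes "bounded_measurable M f" "bounded_measurable M g"
  shows "bounded_measurable M (\<lambda>x. f x + g x)"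
proof -
  obtain K L where "\<And>x. x \<in> space M \<Longrightarrow> \<bar>f x\<bar> \<le> K" "\<And>x. x \<in> space M \<Longrightarrow> \<bar>g x\<bar> \<le> L"
    using assms unfolding bounded_measurable_def by blast
  then have "\<forall>x\<in>space M. \<bar>f x + g x\<bar> \<le> K + L"
    by (meson abs_triangle_ineq add_mono order_trans)
  then show ?thesis
    using assms unfolding bounded_measurable_def by auto
qed

lemma bounded_measurable_mult:
  assumes "bounded_measurable M f" "bounded_measurable M g"
  shows "bounded_measurable M (\<lambda>x. f x * g x)"
proof -
  obtain K L where "\<And>x. x \<in> space M \<Longrightarrow> \<bar>f x\<bar> \<le> K" "\<And>x. x \<in> space M \<Longrightarrow> \<bar>g x\<bar> \<le> L"
    using assms unfolding bounded_measurable_def by blast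
  then have "\<forall>x\<in>space M. \<bar>f x * g x\<bar> \<le> K * L"
    by (auto simp: abs_mult intro!: mult_mono intro: order_trans[OF abs_ge_zero])
  then show ?thesis
    using assms unfolding bounded_measurable_def by auto
qed

lemma bounded_measurable_sum:
  "(\<And>i. i \<in> J \<Longrightarrow> bounded_measurable M (f i)) \<Longrightarrow> bounded_measurable M (\<lambda>x. \<Sum>i\<in>J. f i x)"
  by (induction J rule: infinite_finite_induct)
    (auto intro: bounded_measurable_const bounded_measurable_add)

lemma bounded_measurable_exp:
  assumes "bounded_measurable M f"
  shows "bounded_measurable M (\<lambda>x. exp (f x))"
  using assms unfolding bounded_measurable_def
  by (auto intro!: exI[of _ "exp _"] simp: abs_le_iff)

lemma (in finite_measure) integrable_bounded_measurable:
  assumes "bounded_measurable M f"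
  shows "integrable M f"
proof -
  obtain K where "\<And>x. x \<in> space M \<Longrightarrow> \<bar>f x\<bar> \<le> K"
    using assms unfolding bounded_measurable_def by blast
  then show ?thesis
    using assms by (intro integrable_const_bound[of _ K]) (auto simp: bounded_measurable_def)
qed

lemma bounded_measurable_cong_sets:
  "sets M = sets M' \<Longrightarrow> bounded_measurable M f = bounded_measurable M' f"
  unfolding bounded_measurable_def
  using measurable_cong_sets[of M M' "borel :: real measure" borel] sets_eq_imp_space_eq[of M M'] by simp

locale path_model =
  fixes h :: real and N :: nat and X :: "nat \<Rightarrow> real set"
    and B :: "real \<Rightarrow> real \<Rightarrow> real ^ 'k::finite" and I :: "nat \<Rightarrow> 'i set" and G :: "'i \<Rightarrow> real \<Rightarrow> real"
  assumes h_pos: "0 < h"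
    and B_bcont: "\<And>k. k < N \<Longrightarrow> bcont_on (X k \<times> X (Suc k)) (\<lambda>(x, y). B x y)"
    and I_finite: "\<And>k. k < N \<Longrightarrow> finite (I k)"
    and G_bcont: "\<And>k i. k < N \<Longrightarrow> i \<in> I k \<Longrightarrow> bcont_on (X k) (G i)"
begin

lemma space_path_space: "space (path_space N X) = (\<Pi>\<^sub>E k\<in>{..N}. X k)"
  unfolding path_space_def by (auto simp: space_restrict_space space_PiM PiE_def)

lemma coordinate_measurable:
  assumes "k \<le> N"
  shows "(\<lambda>x. x k) \<in> measurable (path_space N X) (state_space X k)"
  unfolding state_space_def
proof (rule measurable_restrict_space2)
  show "(\<lambda>x. x k) \<in> space (path_space N X) \<rightarrow> X k"
    using assms by (auto simp: space_path_space)
  show "(\<lambda>x. x k) \<in> borel_measurable (path_space N X)"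
    unfolding path_space_def using assms
    by (intro measurable_restrict_space1 measurable_component_singleton) auto
qed

lemma bounded_measurable_coordinate:
  assumes "k < N" "bcont_on (X k) f"
  shows "bounded_measurable (path_space N X) (\<lambda>x. f (x k))"
proof -
  have m: "(\<lambda>x. x k) \<in> measurable (path_space N X) (state_space X k)"
    using assms by (intro coordinate_measurable) simp
  obtain K where K: "\<And>x. x \<in> X k \<Longrightarrow> \<bar>f x\<bar> \<le> K"
    using assms by (auto simp: bcont_on_def bounded_iff)
  have "\<forall>x\<in>space (path_space N X). \<bar>f (x k)\<bar> \<le> K"
    using measurable_space[OF m] K by auto
  then show ?thesis
    using measurable_compose[OF m bcont_on_state_space(1)[where X = X and k = k, OF assms(2)]]
    unfolding bounded_measurable_def by blast
qed

text \<open>\<open>B\<close> is continuous on the product of two consecutive state sets, so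
  measurability is obtained through the pair of coordinates as a map into that restricted
  space.\<close>

lemma bounded_measurable_B:
  assumes "k < N"
  shows "bounded_measurable (path_space N X) (\<lambda>x. B (x k) (x (Suc k)) $ j)"
proof -
  have [measurable]: "(\<lambda>x. x i) \<in> borel_measurable (path_space N X)" if "i \<le> N" for i
    using coordinate_measurable[OF that] unfolding state_space_def measurable_restrict_space2_iff by simp
  have m: "(\<lambda>x. (x k, x (Suc k))) \<in> measurable (path_space N X) (restrict_space borel (X k \<times> X (Suc k)))"
  proof (rule measurable_restrict_space2)
    show "(\<lambda>x. (x k, x (Suc k))) \<in> space (path_space N X) \<rightarrow> X k \<times> X (Suc k)"
      using assms by (auto simp: space_path_space)
    show "(\<lambda>x. (x k, x (Suc k))) \<in> borel_measurable (path_space N X)"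
      using assms by (simp add: borel_measurable_Pair)
  qed
  note bc = bcont_on_component[OF B_bcont[OF assms], of j]
  have "(\<lambda>z. (case z of (x, y) \<Rightarrow> B x y) $ j) \<in> borel_measurable (restrict_space borel (X k \<times> X (Suc k)))"
    using bc unfolding bcont_on_def by (intro borel_measurable_continuous_on_restrict) simp
  from measurable_compose[OF m this]
  have "(\<lambda>x. B (x k) (x (Suc k)) $ j) \<in> borel_measurable (path_space N X)" by simp
  moreover obtain K where K: "\<And>z. z \<in> X k \<times> X (Suc k) \<Longrightarrow> \<bar>(case z of (x, y) \<Rightarrow> B x y) $ j\<bar> \<le> K"
    using bc unfolding bcont_on_def bounded_iff by auto
  then have "\<forall>x\<in>space (path_space N X). \<bar>B (x k) (x (Suc k)) $ j\<bar> \<le> K"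
    using K[of "(x k, x (Suc k))" for x] measurable_space[OF m] by (auto simp: space_restrict_space)
  ultimately show ?thesis
    unfolding bounded_measurable_def by blast
qed

lemma bounded_measurable_Delta:
  assumes "\<Phi> \<in> test_space N X"
  shows "bounded_measurable (path_space N X) (Delta h N B I G \<Phi>)"
proof -
  obtain \<phi> \<psi> \<Lambda> where eq: "\<Phi> = (\<phi>, \<psi>, \<Lambda>)" by (metis prod_cases3)
  have bc: "bcont_on (X k) (\<phi> k)" "bcont_on (X k) (\<lambda>x. \<psi> k x $ j)" if "k < N" for k j
    using assms that unfolding eq test_space_def by (auto intro: bcont_on_component)
  have "bounded_measurable (path_space N X) (\<lambda>x. \<Sum>k<N. h * \<phi> k (x k)
      + (\<Sum>j\<in>UNIV. \<psi> k (x k) $ j * B (x k) (x (Suc k)) $ j) + (\<Sum>i\<in>I k. \<Lambda> k i * G i (x k)))"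
    by (intro bounded_measurable_sum bounded_measurable_add bounded_measurable_mult
        bounded_measurable_const)
      (simp_all add: bounded_measurable_B bounded_measurable_coordinate[OF _ bc(1)]
        bounded_measurable_coordinate[OF _ bc(2)] bounded_measurable_coordinate[OF _ G_bcont])
  moreover have "Delta h N B I G \<Phi> = (\<lambda>x. \<Sum>k<N. h * \<phi> k (x k)
      + (\<Sum>j\<in>UNIV. \<psi> k (x k) $ j * B (x k) (x (Suc k)) $ j) + (\<Sum>i\<in>I k. \<Lambda> k i * G i (x k)))"
    by (simp add: eq fun_eq_iff inner_vec_def)
  ultimately show ?thesis by simp
qed

section \<open>The adjoint on finite path measures of arbitrary mass\<close>

context
  fixes P :: "(nat \<Rightarrow> real) measure"
  assumes finP: "finite_measure P" and setsP: "sets P = sets (path_space N X)"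
begin

interpretation finite_measure P by (rule finP)

lemma integrable_path: "bounded_measurable (path_space N X) f \<Longrightarrow> integrable P f"
  using bounded_measurable_cong_sets[OF setsP] integrable_bounded_measurable by blast

lemma coordinate_measurable_P: "k < N \<Longrightarrow> (\<lambda>x. x k) \<in> measurable P (state_space X k)"
  using coordinate_measurable[of k] by (simp add: measurable_cong_sets[OF setsP refl])

lemma integrable_B: "k < N \<Longrightarrow> integrable P (\<lambda>x. B (x k) (x (Suc k)))"
proof -
  assume k: "k < N"
  have "integrable P (\<lambda>x. \<Sum>j\<in>UNIV. B (x k) (x (Suc k)) $ j *\<^sub>R axis j (1::real))"
    by (intro Bochner_Integration.integrable_sum integrable_scaleR_left)
      (simp add: integrable_path bounded_measurable_B k)
  moreover have "(\<Sum>j\<in>UNIV. B y z $ j *\<^sub>R axis j (1::real)) = B y z" for y z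
    by (simp add: vec_eq_iff axis_def if_distrib sum.delta cong: if_cong)
  ultimately show ?thesis by simp
qed

text \<open>The weight \<open>h\<close> is put inside the integral so that marginals take the same
  form as moment measures, that of a restricted expectation.\<close>

lemma marginal_eq:
  assumes "k < N" "A \<in> sets (state_space X k)"
  shows "h * measure (marginal X P k) A = (\<integral>x. indicator A (x k) * h \<partial>P)"
proof -
  note m = coordinate_measurable_P[OF assms(1)]
  have "(\<integral>x. indicator A (x k) \<partial>P) = (\<integral>x. indicator A x \<partial>marginal X P k :: real)"
    unfolding marginal_def using assms(2) integral_distr[OF m, of "indicator A :: real \<Rightarrow> real"] by simp
  also have "\<dots> = measure (marginal X P k) A"
    using assms(2) sets.sets_into_space[OF assms(2)] by (simp add: marginal_def Int_absorb2)
  finally show ?thesis by simp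
qed

text \<open>Integrating the conditional expectation over \<open>A\<close> recovers the restricted
  expectation of \<open>B\<close>, and the factor \<open>1 / h\<close> cancels.\<close>

lemma moment_measure_eq:
  assumes "k < N" "A \<in> sets (state_space X k)"
  shows "(h *\<^sub>R moment_measure h X B P k A) $ j = (\<integral>x. indicator A (x k) * B (x k) (x (Suc k)) $ j \<partial>P)"
proof -
  note m = coordinate_measurable_P[OF assms(1)]
  let ?c = "cond_exp_given P (state_space X k) (\<lambda>x. x k) (\<lambda>x. B (x k) (x (Suc k)))"
  have "moment_measure h X B P k A = (1 / h) *\<^sub>R (LINT x:A|distr P (state_space X k) (\<lambda>x. x k). ?c x)"
    unfolding moment_measure_def marginal_def set_lebesgue_integral_def
      integral_scaleR_right[symmetric]
    by (intro Bochner_Integration.integral_cong) auto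
  also have "\<dots> = (1 / h) *\<^sub>R (\<integral>x. indicator A (x k) *\<^sub>R B (x k) (x (Suc k)) \<partial>P)"
    by (subst integral_cond_exp_given[OF finP m integrable_B[OF assms(1)] assms(2)]) simp
  finally have "h *\<^sub>R moment_measure h X B P k A = (\<integral>x. indicator A (x k) *\<^sub>R B (x k) (x (Suc k)) \<partial>P)"
    using h_pos by simp
  moreover have int: "integrable P (\<lambda>x. indicator A (x k) *\<^sub>R B (x k) (x (Suc k)))"
  proof -
    note [measurable] = m assms(2)
    show ?thesis
      by (rule Bochner_Integration.integrable_bound[OF integrable_B[OF assms(1)]])
        (use integrable_B[OF assms(1)] in \<open>auto simp: indicator_def\<close>)
  qed
  ultimately show ?thesis
    using integral_bounded_linear[OF bounded_linear_vec_nth int, of j] by simp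
qed

lemma Delta_adj_mem: "Delta_adj h X B G P \<in> dual_space N X"
proof -
  have "vector_measure (state_space X k) (\<lambda>A. h * measure (marginal X P k) A)" if "k < N" for k
    by (rule vector_measure_cong[THEN iffD2, rotated,
          OF vector_measure_restricted_expectation[OF finP coordinate_measurable_P[OF that]
            integrable_path[OF bounded_measurable_const[of _ h]]]])
      (rule marginal_eq[OF that])
  moreover have "vector_measure (state_space X k) (\<lambda>A. h *\<^sub>R moment_measure h X B P k A)"
    if k: "k < N" for k
  proof (rule vector_measure_componentwise)
    fix j
    show "vector_measure (state_space X k) (\<lambda>A. (h *\<^sub>R moment_measure h X B P k A) $ j)"
      by (rule vector_measure_cong[THEN iffD2, rotated,
            OF vector_measure_restricted_expectation[OF finP coordinate_measurable_P[OF k]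
              integrable_path[OF bounded_measurable_B[OF k]]]])
        (rule moment_measure_eq[OF k])
  qed
  ultimately show ?thesis
    by (simp add: Delta_adj_def dual_space_def)
qed

text \<open>Marginals and moment measures are restricted expectations, so pairing them with a test
  function multiplies the weight by that function of the coordinate. Prices are expectations
  already, and boundedness lets the integral pass through the finite sums.\<close>

lemma pairing_Delta_adj:
  assumes "\<Phi> \<in> test_space N X"
  shows "pairing N X I \<Phi> (Delta_adj h X B G P) = (\<integral>x. Delta h N B I G \<Phi> x \<partial>P)"
proof -
  obtain \<phi> \<psi> \<Lambda> where eq: "\<Phi> = (\<phi>, \<psi>, \<Lambda>)" by (metis prod_cases3)
  have bc: "bcont_on (X k) (\<phi> k)" "bcont_on (X k) (\<lambda>x. \<psi> k x $ j)" if "k < N" for k j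
    using assms that unfolding eq test_space_def by (auto intro: bcont_on_component)
  have s: "signed_integral (state_space X k) (\<lambda>A. h * measure (marginal X P k) A) (\<phi> k) =
      (\<integral>x. \<phi> k (x k) * h \<partial>P)" if k: "k < N" for k
    by (intro trans[OF signed_integral_cong[OF marginal_eq[OF k]]]
        signed_integral_restricted_expectation finP coordinate_measurable_P k
        bcont_on_state_space bc integrable_path bounded_measurable_const)
  have v: "vector_integral (state_space X k) (\<lambda>A. h *\<^sub>R moment_measure h X B P k A) (\<psi> k) =
      (\<Sum>j\<in>UNIV. \<integral>x. \<psi> k (x k) $ j * B (x k) (x (Suc k)) $ j \<partial>P)" if k: "k < N" for k
    unfolding vector_integral_def
    by (intro sum.cong refl trans[OF signed_integral_cong[OF moment_measure_eq[OF k]]]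
        signed_integral_restricted_expectation finP coordinate_measurable_P k
        bcont_on_state_space bc integrable_path bounded_measurable_B)
  have int: "integrable P (\<lambda>x. \<phi> k (x k) * h)"
    "integrable P (\<lambda>x. \<psi> k (x k) $ j * B (x k) (x (Suc k)) $ j)" if k: "k < N" for k j
    by (intro integrable_path bounded_measurable_mult bounded_measurable_const
        bounded_measurable_coordinate bounded_measurable_B k bc)+
  have intG: "integrable P (\<lambda>x. \<Lambda> k i * G i (x k))" if "k < N" "i \<in> I k" for k i
    using that by (intro integrable_path bounded_measurable_mult bounded_measurable_const
        bounded_measurable_coordinate G_bcont)
  have p: "(\<Sum>i\<in>I k. \<Lambda> k i * price G P k i) = (\<integral>x. (\<Sum>i\<in>I k. \<Lambda> k i * G i (x k)) \<partial>P)" if "k < N" for k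
    using intG[OF that] by (simp add: price_def)
  have split: "(\<integral>x. \<phi> k (x k) * h + (\<Sum>j\<in>UNIV. \<psi> k (x k) $ j * B (x k) (x (Suc k)) $ j)
        + (\<Sum>i\<in>I k. \<Lambda> k i * G i (x k)) \<partial>P) =
      (\<integral>x. \<phi> k (x k) * h \<partial>P) + (\<Sum>j\<in>UNIV. \<integral>x. \<psi> k (x k) $ j * B (x k) (x (Suc k)) $ j \<partial>P)
        + (\<integral>x. (\<Sum>i\<in>I k. \<Lambda> k i * G i (x k)) \<partial>P)" if k: "k < N" for k
    by (subst Bochner_Integration.integral_sum[symmetric], rule int(2)[OF k])
      (intro trans[OF Bochner_Integration.integral_add] arg_cong2[of _ _ _ _ "(+)"] refl
        Bochner_Integration.integral_add Bochner_Integration.integrable_add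
        Bochner_Integration.integrable_sum int intG k)
  have "pairing N X I \<Phi> (Delta_adj h X B G P) = (\<Sum>k<N. \<integral>x. \<phi> k (x k) * h
      + (\<Sum>j\<in>UNIV. \<psi> k (x k) $ j * B (x k) (x (Suc k)) $ j) + (\<Sum>i\<in>I k. \<Lambda> k i * G i (x k)) \<partial>P)"
    unfolding eq Delta_adj_def pairing.simps
    by (intro sum.cong refl) (simp only: split s v p lessThan_iff)
  also have "\<dots> = (\<integral>x. (\<Sum>k<N. \<phi> k (x k) * h
      + (\<Sum>j\<in>UNIV. \<psi> k (x k) $ j * B (x k) (x (Suc k)) $ j) + (\<Sum>i\<in>I k. \<Lambda> k i * G i (x k))) \<partial>P)"
    by (intro Bochner_Integration.integral_sum[symmetric] Bochner_Integration.integrable_add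
        Bochner_Integration.integrable_sum int intG) auto
  also have "\<dots> = (\<integral>x. Delta h N B I G \<Phi> x \<partial>P)"
    unfolding eq by (simp add: inner_vec_def mult.commute)
  finally show ?thesis .
qed

end

end

section \<open>Optimality\<close>

text \<open>For negative \<open>s\<close> the product of \<open>1 + s + s\<^sup>2\<close> and
  \<open>1 - s\<close> is one minus the cube of \<open>s\<close>, hence at least 1, while
  \<open>1 - s \<le> exp (- s)\<close>.\<close>

lemma exp_le_quadratic:
  fixes s :: real
  assumes "\<bar>s\<bar> \<le> 1"
  shows "exp s \<le> 1 + s + s\<^sup>2"
proof (cases "0 \<le> s")
  case True
  then show ?thesis using assms by (intro exp_bound) auto
next
  case False
  then have s: "0 < 1 - s" using assms by simp
  have "1 \<le> (1 + s + s\<^sup>2) * (1 - s)"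
    using False mult_nonpos_nonneg[of s "s * s"] by (simp add: algebra_simps power2_eq_square)
  also have "\<dots> \<le> (1 + s + s\<^sup>2) * exp (- s)"
    using exp_ge_add_one_self[of "- s"] s assms by (intro mult_left_mono) auto
  finally show ?thesis
    by (simp add: exp_minus field_simps)
qed

context path_model
begin

interpretation dual: weak_duality "test_space N X" "dual_space N X" "pairing N X I" test_lin dual_comb
  by (rule weak_duality_pairing)

lemma conj_eq: "dual.conj = conjugate N X I"
  by (simp add: fun_eq_iff dual.conj_def conjugate_def)

lemma weak_eq: "dual.weak = weak_topology N X I"
  by (simp add: dual.weak_def weak_topology_def)

lemma pairing_uminus:
  "\<Phi> \<in> test_space N X \<Longrightarrow> \<xi> \<in> dual_space N X \<Longrightarrow> pairing N X I (- \<Phi>) \<xi> = - pairing N X I \<Phi> \<xi>"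
  unfolding uminus_test by (simp add: pairing_test_lin)

lemma bounded_measurable_exponent:
  "\<Phi> \<in> test_space N X \<Longrightarrow> bounded_measurable (path_space N X) (\<lambda>x. Delta h N B I G \<Phi> x / h)"
  using bounded_measurable_mult[OF bounded_measurable_Delta bounded_measurable_const[of _ "1 / h"]]
  by simp

section \<open>Optimality conditions at a dual maximiser\<close>

context
  fixes Q :: "(nat \<Rightarrow> real) measure" and f :: "('k, 'i) dual \<Rightarrow> ereal" and \<Phi> :: "('k, 'i) test"
  assumes finQ: "finite_measure Q" and setsQ: "sets Q = sets (path_space N X)"
    and f_proper: "proper_on (dual_space N X) f"
    and f_conv: "convex_ext_on dual_comb (dual_space N X) f"
    and f_lsc: "lsc_in (weak_topology N X I) f"
    and \<Phi>: "\<Phi> \<in> test_space N X"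
    and maximal: "\<And>\<Psi>. \<Psi> \<in> test_space N X \<Longrightarrow>
      dual_objective h N X I B G f Q \<Psi> \<le> dual_objective h N X I B G f Q \<Phi>"
begin

interpretation Q: finite_measure Q by (rule finQ)

abbreviation "P\<^sub>\<Phi> \<equiv> induced_measure h N I B G Q \<Phi>"

lemma integrable_exp:
  "\<Psi> \<in> test_space N X \<Longrightarrow> integrable Q (\<lambda>x. exp (Delta h N B I G \<Psi> x / h))"
  by (intro integrable_path finQ setsQ bounded_measurable_exp bounded_measurable_exponent)

lemma sets_induced: "sets P\<^sub>\<Phi> = sets (path_space N X)"
  by (simp add: induced_measure_def setsQ)

lemma finite_measure_induced: "finite_measure P\<^sub>\<Phi>"
  unfolding induced_measure_def by (rule finite_measure_density_real[OF integrable_exp[OF \<Phi>]])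

text \<open>The conjugate is finite somewhere by \<open>conj_proper\<close>, so some dual value
  exceeds minus infinity; the maximum then does too, which excludes an infinite conjugate at
  \<open>- \<Phi>\<close>.\<close>

lemma conjugate_maximizer: "\<exists>a. conjugate N X I f (- \<Phi>) = ereal a"
proof -
  obtain \<Psi> where \<Psi>: "\<Psi> \<in> test_space N X" "conjugate N X I f \<Psi> \<noteq> \<infinity>"
    using dual.conj_proper[of f] f_proper f_conv f_lsc by (auto simp: conj_eq weak_eq)
  have "- (- \<Psi>) = \<Psi>" by (cases \<Psi>) (simp add: fun_eq_iff)
  then have "dual_objective h N X I B G f Q (- \<Psi>) \<noteq> - \<infinity>"
    using \<Psi>(2) by (cases "conjugate N X I f \<Psi>") (auto simp: dual_objective_def)
  then have "dual_objective h N X I B G f Q \<Phi> \<noteq> - \<infinity>"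
    using maximal[OF uminus_test_mem[OF \<Psi>(1)]] by auto
  then have "conjugate N X I f (- \<Phi>) \<noteq> \<infinity>"
    by (auto simp: dual_objective_def)
  moreover have "conjugate N X I f (- \<Phi>) \<noteq> - \<infinity>"
    using dual.conj_not_MInf[OF f_proper] by (simp add: conj_eq)
  ultimately show ?thesis by (cases "conjugate N X I f (- \<Phi>)") auto
qed

text \<open>First-order optimality along the segment from \<open>\<Phi>\<close> to \<open>\<Psi>\<close>: the exponential term has
  derivative \<open>E[\<Delta>\<Psi> - \<Delta>\<Phi>]\<close> under the induced measure.\<close>

lemma maximizer_subgradient:
  assumes a: "conjugate N X I f (- \<Phi>) = ereal a"
    and \<Psi>: "\<Psi> \<in> test_space N X" and b: "conjugate N X I f (- \<Psi>) \<le> ereal b"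
  shows "a - b \<le> pairing N X I \<Psi> (Delta_adj h X B G P\<^sub>\<Phi>) - pairing N X I \<Phi> (Delta_adj h X B G P\<^sub>\<Phi>)"
proof -
  define u where "u x = Delta h N B I G \<Phi> x / h" for x
  define w where "w x = Delta h N B I G \<Psi> x / h - Delta h N B I G \<Phi> x / h" for x
  have bm_u: "bounded_measurable (path_space N X) u"
    unfolding u_def by (rule bounded_measurable_exponent[OF \<Phi>])
  have bm_w: "bounded_measurable (path_space N X) w"
    using bounded_measurable_add[OF bounded_measurable_exponent[OF \<Psi>]
        bounded_measurable_mult[OF bounded_measurable_const[of _ "- 1"] bounded_measurable_exponent[OF \<Phi>]]]
    unfolding w_def by simp
  note int = integrable_path[OF finQ setsQ]
  obtain K0 where K0: "\<And>x. x \<in> space Q \<Longrightarrow> \<bar>w x\<bar> \<le> K0"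
    using bm_w sets_eq_imp_space_eq[OF setsQ] unfolding bounded_measurable_def by blast
  \<comment> \<open>With \<open>K\<close> at least 1, the single condition \<open>t < 1 / K\<close>
    keeps \<open>t\<close> inside the segment and also \<open>t * w\<close> within the range of the
    quadratic bound on \<open>exp\<close>.\<close>
  define K where "K = max 1 K0"
  have K: "1 \<le> K" "\<And>x. x \<in> space Q \<Longrightarrow> \<bar>w x\<bar> \<le> K"
    using K0 by (auto simp: K_def le_max_iff_disj)
  define E0 where "E0 = (\<integral>x. exp (u x) \<partial>Q)"
  define W where "W = (\<integral>x. exp (u x) * w x \<partial>Q)"
  have int_exp: "integrable Q (\<lambda>x. exp (u x))"
    and int_expw: "integrable Q (\<lambda>x. exp (u x) * w x)"
    and int_exptw: "integrable Q (\<lambda>x. exp (u x + t * w x))" for t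
    by (intro int bounded_measurable_exp bounded_measurable_mult bounded_measurable_add
        bounded_measurable_const bm_u bm_w)+
  have ineq: "a - b \<le> h * W + t * (h * K\<^sup>2 * E0)" if t: "0 < t" "t < 1 / K" for t
  proof -
    have "t \<le> 1" "t * K \<le> 1"
      using t K(1) by (auto simp: field_simps intro: order_trans[of t "t * K" 1])
    let ?\<Phi>t = "test_lin (1 - t) \<Phi> t \<Psi>"
    have "conjugate N X I f (- ?\<Phi>t) \<le> ereal ((1 - t) * a + t * b)"
      using dual.conj_convex[OF f_proper uminus_test_mem[OF \<Phi>] uminus_test_mem[OF \<Psi>], of t a b]
        a b t \<open>t \<le> 1\<close> by (simp add: conj_eq uminus_test_lin)
    moreover have "conjugate N X I f (- ?\<Phi>t) \<noteq> - \<infinity>"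
      using dual.conj_not_MInf[OF f_proper] by (simp add: conj_eq)
    \<comment> \<open>Convexity along the segment bounds the conjugate above and properness bounds
      it below, so the comparison with the maximum takes place between reals.\<close>
    ultimately obtain c where c: "conjugate N X I f (- ?\<Phi>t) = ereal c" "c \<le> (1 - t) * a + t * b"
      by (cases "conjugate N X I f (- ?\<Phi>t)") auto
    have "Delta h N B I G ?\<Phi>t x / h = u x + t * w x" for x
      using h_pos by (simp add: Delta_test_lin u_def w_def field_simps)
    then have "- c - h * (\<integral>x. exp (u x + t * w x) \<partial>Q) \<le> - a - h * E0"
      using maximal[OF test_lin_mem[OF \<Phi> \<Psi>], of "1 - t" t] c(1) a
      by (simp add: dual_objective_def E0_def u_def)
    moreover have "(\<integral>x. exp (u x + t * w x) \<partial>Q) \<le> E0 + t * W + t\<^sup>2 * K\<^sup>2 * E0"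
    proof -
      have "exp (u x + t * w x) \<le> exp (u x) + t * (exp (u x) * w x) + t\<^sup>2 * K\<^sup>2 * exp (u x)"
        if x: "x \<in> space Q" for x
      proof -
        have "\<bar>t * w x\<bar> \<le> t * K"
          using K(2)[OF x] t by (simp add: abs_mult)
        then have "exp (t * w x) \<le> 1 + t * w x + (t * w x)\<^sup>2" "(t * w x)\<^sup>2 \<le> (t * K)\<^sup>2"
          using \<open>t * K \<le> 1\<close> by (auto intro!: exp_le_quadratic simp: abs_le_square_iff[symmetric])
        then have "exp (u x) * exp (t * w x) \<le> exp (u x) * (1 + t * w x + (t * K)\<^sup>2)"
          by (intro mult_left_mono) auto
        then show ?thesis
          by (simp add: exp_add algebra_simps power_mult_distrib)
      qed
      then have "(\<integral>x. exp (u x + t * w x) \<partial>Q) \<le>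
          (\<integral>x. exp (u x) + t * (exp (u x) * w x) + t\<^sup>2 * K\<^sup>2 * exp (u x) \<partial>Q)"
        using int_exp int_expw int_exptw by (intro integral_mono) auto
      also have "\<dots> = E0 + t * W + t\<^sup>2 * K\<^sup>2 * E0"
        using int_exp int_expw by (simp add: E0_def W_def)
      finally show ?thesis .
    qed
    then have "h * (\<integral>x. exp (u x + t * w x) \<partial>Q) \<le> h * (E0 + t * W + t\<^sup>2 * K\<^sup>2 * E0)"
      using h_pos by (intro mult_left_mono) auto
    ultimately have "t * (a - b) \<le> t * (h * W + t * (h * K\<^sup>2 * E0))"
      using c(2) by (simp add: algebra_simps power2_eq_square)
    then show ?thesis using t by simp
  qed
  \<comment> \<open>The conjugate need not be differentiable. Its convexity bound is linear in
    \<open>t\<close>, so after division by \<open>t\<close> the one-sided limit concerns the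
    exponential term alone.\<close>
  have "((\<lambda>t. h * W + t * (h * K\<^sup>2 * E0)) \<longlongrightarrow> h * W + 0 * (h * K\<^sup>2 * E0)) (at_right 0)"
    by (intro tendsto_intros)
  moreover have "eventually (\<lambda>t. a - b \<le> h * W + t * (h * K\<^sup>2 * E0)) (at_right 0)"
    using ineq K(1) by (auto simp: eventually_at_right_field intro!: exI[of _ "1 / K"])
  ultimately have "a - b \<le> h * W + 0 * (h * K\<^sup>2 * E0)"
    by (intro tendsto_lowerbound) auto
  \<comment> \<open>\<open>exp u\<close> is the density of the induced measure, so \<open>W\<close>
    is the expectation of \<open>w\<close> under it; the adjoint relation turns expectations of
    \<open>Delta\<close> into pairings.\<close>
  moreover have "h * W = pairing N X I \<Psi> (Delta_adj h X B G P\<^sub>\<Phi>) - pairing N X I \<Phi> (Delta_adj h X B G P\<^sub>\<Phi>)"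
  proof -
    note intP = integrable_path[OF finite_measure_induced sets_induced]
    have meas: "w \<in> borel_measurable Q" "u \<in> borel_measurable Q"
      using bm_w bm_u measurable_cong_sets[OF setsQ, of "borel :: real measure" borel]
      by (auto simp: bounded_measurable_def)
    have "W = (\<integral>x. w x \<partial>P\<^sub>\<Phi>)"
      unfolding W_def induced_measure_def u_def[symmetric]
      using meas by (subst integral_density) auto
    also have "\<dots> = (\<integral>x. Delta h N B I G \<Psi> x \<partial>P\<^sub>\<Phi>) / h - (\<integral>x. Delta h N B I G \<Phi> x \<partial>P\<^sub>\<Phi>) / h"
      unfolding w_def
      by (simp add: intP[OF bounded_measurable_Delta[OF \<Psi>]] intP[OF bounded_measurable_Delta[OF \<Phi>]])
    finally show ?thesis
      using h_pos pairing_Delta_adj[OF finite_measure_induced sets_induced \<Phi>]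
        pairing_Delta_adj[OF finite_measure_induced sets_induced \<Psi>]
      by (simp add: field_simps)
  qed
  ultimately show ?thesis by simp
qed

text \<open>Each term of the biconjugate is controlled by the subgradient inequality, applied at
  \<open>- \<Psi>\<close> because the dual objective evaluates the conjugate at negated arguments.
  Terms with infinite conjugate drop out. This one-sided bound suffices, Fenchel-Young giving the
  opposite one.\<close>

lemma value_at_induced:
  assumes a: "conjugate N X I f (- \<Phi>) = ereal a"
  shows "f (Delta_adj h X B G P\<^sub>\<Phi>) \<le> ereal (- pairing N X I \<Phi> (Delta_adj h X B G P\<^sub>\<Phi>) - a)"
proof -
  let ?\<xi> = "Delta_adj h X B G P\<^sub>\<Phi>"
  have \<xi>: "?\<xi> \<in> dual_space N X"
    by (rule Delta_adj_mem[OF finite_measure_induced sets_induced])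
  have "f ?\<xi> = (SUP \<Psi>\<in>test_space N X. ereal (pairing N X I \<Psi> ?\<xi>) - conjugate N X I f \<Psi>)"
    using dual.Fenchel_Moreau[OF f_proper f_conv _ \<xi>] f_lsc by (simp add: conj_eq weak_eq)
  also have "\<dots> \<le> ereal (- pairing N X I \<Phi> ?\<xi> - a)"
  proof (rule SUP_least)
    fix \<Psi> :: "('k, 'i) test" assume \<Psi>: "\<Psi> \<in> test_space N X"
    have neg: "- (- \<Psi>) = \<Psi>" by (cases \<Psi>) (simp add: fun_eq_iff)
    show "ereal (pairing N X I \<Psi> ?\<xi>) - conjugate N X I f \<Psi> \<le> ereal (- pairing N X I \<Phi> ?\<xi> - a)"
    proof (cases "conjugate N X I f \<Psi>")
      case (real b)
      then have "a - b \<le> pairing N X I (- \<Psi>) ?\<xi> - pairing N X I \<Phi> ?\<xi>"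
        using maximizer_subgradient[OF a uminus_test_mem[OF \<Psi>], of b] by (simp add: neg)
      then show ?thesis
        using pairing_uminus[OF \<Psi> \<xi>] real by simp
    next
      case MInf
      then show ?thesis using dual.conj_not_MInf[OF f_proper, of \<Psi>] by (simp add: conj_eq)
    qed simp
  qed
  finally show ?thesis .
qed

text \<open>Lower bounds for the two summands of the primal objective contain the expectation of
  \<open>Delta\<close> with opposite signs, so their sum is the same constant for every competitor,
  and the induced measure reaches it.\<close>

lemma induced_optimal:
  assumes prob: "prob_space P\<^sub>\<Phi>"
  shows "is_arg_min (primal_objective h X B G f Q) (\<lambda>P. P \<in> space (prob_algebra (path_space N X))) P\<^sub>\<Phi>"
    and "is_arg_min (primal_objective h X B G f Q) (\<lambda>P. P \<in> space (prob_algebra (path_space N X))) P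
      \<Longrightarrow> P = P\<^sub>\<Phi>"
proof -
  obtain a where a: "conjugate N X I f (- \<Phi>) = ereal a"
    using conjugate_maximizer by blast
  define u where "u x = Delta h N B I G \<Phi> x / h" for x
  have bm_u: "bounded_measurable Q u"
    using bounded_measurable_exponent[OF \<Phi>] bounded_measurable_cong_sets[OF setsQ]
    unfolding u_def by blast
  then obtain K where K: "\<forall>x\<in>space Q. \<bar>u x\<bar> \<le> K"
    unfolding bounded_measurable_def by blast
  have u: "u \<in> borel_measurable Q" using bm_u by (simp add: bounded_measurable_def)
  have P_eq: "P\<^sub>\<Phi> = density Q (\<lambda>x. ennreal (exp (u x)))"
    by (simp add: induced_measure_def u_def)
  have pair: "pairing N X I \<Phi> (Delta_adj h X B G P) = h * (\<integral>x. u x \<partial>P)"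
    if "finite_measure P" "sets P = sets (path_space N X)" for P
    using pairing_Delta_adj[OF that \<Phi>] h_pos by (simp add: u_def)
  have upper: "primal_objective h X B G f Q P\<^sub>\<Phi> \<le> ereal (- a - h)"
  proof -
    have "f (Delta_adj h X B G P\<^sub>\<Phi>) + ereal h * KL P\<^sub>\<Phi> Q \<le>
        ereal (- (h * (\<integral>x. u x \<partial>P\<^sub>\<Phi>)) - a) + ereal (h * ((\<integral>x. u x \<partial>P\<^sub>\<Phi>) - 1))"
      using value_at_induced[OF a] KL_exp_density[OF finQ u K P_eq prob]
      by (intro add_mono) (auto simp: pair[OF finite_measure_induced sets_induced])
    also have "\<dots> = ereal (- a - h)"
      by (simp add: right_diff_distrib)
    finally show ?thesis
      by (simp only: primal_objective_def)
  qed
  have lower: "ereal (- a - h) \<le> primal_objective h X B G f Q P"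
    and lower_eq: "primal_objective h X B G f Q P \<le> ereal (- a - h) \<Longrightarrow> P = P\<^sub>\<Phi>"
    if P: "P \<in> space (prob_algebra (path_space N X))" for P
  proof -
    have probP: "prob_space P" and sP: "sets P = sets (path_space N X)"
      using P by (auto simp: space_prob_algebra)
    interpret P: prob_space P by (rule probP)
    have sPQ: "sets P = sets Q" using sP setsQ by simp
    let ?\<xi> = "Delta_adj h X B G P"
    have \<xi>: "?\<xi> \<in> dual_space N X"
      by (rule Delta_adj_mem[OF P.finite_measure_axioms sP])
    have f_low: "ereal (- (h * (\<integral>x. u x \<partial>P)) - a) \<le> f ?\<xi>"
      using dual.Fenchel_Young[OF \<xi>, of "- \<Phi>" f] a pairing_uminus[OF \<Phi> \<xi>]
        pair[OF P.finite_measure_axioms sP]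
      by (cases "f ?\<xi>") (auto simp: conj_eq)
    note KL_low = KL_exp_density_lower[OF finQ u K P_eq prob probP sPQ]
    have "ereal h * ereal ((\<integral>x. u x \<partial>P) - 1) \<le> ereal h * KL P Q"
      using h_pos KL_low(1) by (intro ereal_mult_left_mono) auto
    then have "ereal (- (h * (\<integral>x. u x \<partial>P)) - a) + ereal h * ereal ((\<integral>x. u x \<partial>P) - 1) \<le>
        primal_objective h X B G f Q P"
      unfolding primal_objective_def using f_low by (intro add_mono)
    moreover have "- (h * (\<integral>x. u x \<partial>P)) - a + h * ((\<integral>x. u x \<partial>P) - 1) = - a - h"
      by (simp add: algebra_simps)
    ultimately show "ereal (- a - h) \<le> primal_objective h X B G f Q P"
      by (simp only: plus_ereal.simps times_ereal.simps)
    assume le: "primal_objective h X B G f Q P \<le> ereal (- a - h)"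
    \<comment> \<open>Both summands of the objective have finite lower bounds that add up to
      \<open>- a - h\<close>. A total not above this leaves no slack in the entropy term.\<close>
    have "KL P Q = ereal ((\<integral>x. u x \<partial>P) - 1)"
    proof (rule antisym[OF _ KL_low(1)])
      show "KL P Q \<le> ereal ((\<integral>x. u x \<partial>P) - 1)"
      proof (cases "KL P Q")
        case (real l)
        have "h * l \<le> h * ((\<integral>x. u x \<partial>P) - 1)"
          using le f_low real unfolding primal_objective_def
          by (cases "f ?\<xi>") (auto simp: algebra_simps)
        then show ?thesis
          using real h_pos by simp
      next
        case PInf
        then show ?thesis
          using le f_low h_pos unfolding primal_objective_def
          by (cases "f ?\<xi>") auto
      qed simp
    qed
    then show "P = P\<^sub>\<Phi>" by (rule KL_low(2))
  qed
  have mem: "P\<^sub>\<Phi> \<in> space (prob_algebra (path_space N X))"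
    using prob sets_induced by (simp add: space_prob_algebra)
  show "is_arg_min (primal_objective h X B G f Q) (\<lambda>P. P \<in> space (prob_algebra (path_space N X))) P\<^sub>\<Phi>"
    unfolding is_arg_min_def using mem lower upper by (meson leD order_trans)
  assume "is_arg_min (primal_objective h X B G f Q) (\<lambda>P. P \<in> space (prob_algebra (path_space N X))) P"
  then show "P = P\<^sub>\<Phi>"
    unfolding is_arg_min_def using mem lower_eq upper by (meson leI order_trans)
qed

end

end

section \<open>Finiteness of the reference measure\<close>

lemma finite_measure_distr_any:
  assumes "finite_measure M"
  shows "finite_measure (distr M M' f)"
proof -
  interpret finite_measure M by fact
  \<comment> \<open>\<open>distr\<close> is built by \<open>measure_of\<close>, whose value is
    either the mass of a preimage under \<open>M\<close> or the default 0; both are finite.\<close>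
  have "emeasure (distr M M' f) (space M') \<noteq> \<infinity>"
    unfolding distr_def emeasure_measure_of_conv by simp
  then show ?thesis by (intro finite_measureI) simp
qed

lemma finite_measure_noise_law:
  assumes "\<rho> \<in> space (prob_algebra borel)"
  shows "finite_measure (noise_law N \<rho>)"
proof -
  interpret \<rho>: prob_space \<rho>
    using assms by (simp add: space_prob_algebra)
  interpret Z: prob_space "\<Pi>\<^sub>M k\<in>{..<N}. density lborel (\<lambda>x. ennreal (std_normal_density x))"
    by (intro prob_space_PiM prob_space_normal_density) simp
  interpret pair_prob_space \<rho> "\<Pi>\<^sub>M k\<in>{..<N}. density lborel (\<lambda>x. ennreal (std_normal_density x))" ..
  show ?thesis
    unfolding noise_law_def by unfold_locales
qed

lemma sets_ref_measure: "sets (ref_measure h N X \<mu> \<sigma> \<rho>) = sets (path_space N X)"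
  unfolding ref_measure_def path_space_def by (rule sets_restrict_space_cong) simp

lemma finite_measure_ref_measure:
  assumes "\<rho> \<in> space (prob_algebra borel)" "\<And>k. k \<le> N \<Longrightarrow> X k \<in> sets borel"
  shows "finite_measure (ref_measure h N X \<mu> \<sigma> \<rho>)"
  unfolding ref_measure_def
  by (intro finite_measure_restrict_space finite_measure_distr_any finite_measure_noise_law assms)
    (auto intro!: sets_PiM_I_finite assms)

theorem proposition3p1:
  fixes h :: real and N :: nat and X :: "nat \<Rightarrow> real set"
    and \<mu> \<sigma> :: "real \<Rightarrow> real \<Rightarrow> real" and \<rho>\<^sub>0 :: "real measure"
    and B :: "real \<Rightarrow> real \<Rightarrow> real ^ 'k"
    and I :: "nat \<Rightarrow> 'i set" and G :: "'i \<Rightarrow> real \<Rightarrow> real"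
    and C :: "nat \<Rightarrow> ('i \<Rightarrow> real) \<Rightarrow> ereal" and F :: "real ^ 'k \<Rightarrow> ereal"
    and \<nu>\<^sub>0 :: "real measure" and \<Phi> :: "('k, 'i) test"
  defines "Q \<equiv> ref_measure h N X \<mu> \<sigma> \<rho>\<^sub>0"
  defines "Fh \<equiv> F_h h N X I C F \<nu>\<^sub>0"
  defines "Ph \<equiv> induced_measure h N I B G Q \<Phi>"
  assumes "0 < h" and "1 \<le> N"
    and "\<And>k. k \<le> N \<Longrightarrow> X k \<in> sets borel"
    and "\<rho>\<^sub>0 \<in> space (prob_algebra borel)"
    and "\<And>k. k < N \<Longrightarrow> (\<lambda>x. \<mu> x (real k * h)) \<in> borel_measurable borel"
    and "\<And>k. k < N \<Longrightarrow> (\<lambda>x. \<sigma> x (real k * h)) \<in> borel_measurable borel"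
    and "AE (y, z) in noise_law N \<rho>\<^sub>0. \<forall>k\<le>N. euler_chain h \<mu> \<sigma> y z k \<in> X k"
    and "\<And>k. k < N \<Longrightarrow> bcont_on (X k \<times> X (Suc k)) (\<lambda>(x, y). B x y)"
    and "\<And>k. k < N \<Longrightarrow> finite (I k)"
    and "\<And>k i. k < N \<Longrightarrow> i \<in> I k \<Longrightarrow> bcont_on (X k) (G i)"
    and "\<And>k g. k < N \<Longrightarrow> g \<in> I k \<rightarrow>\<^sub>E UNIV \<Longrightarrow> C k g \<noteq> - \<infinity>"
    and "\<And>k. k < N \<Longrightarrow> convex_ext_on (fun_comb (I k)) (I k \<rightarrow>\<^sub>E UNIV) (C k)"
    and "\<And>k g. k < N \<Longrightarrow> I k = {} \<Longrightarrow> g \<in> I k \<rightarrow>\<^sub>E UNIV \<Longrightarrow> C k g = 0"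
    and "proper_on UNIV F"
    and "convex_ext_on (\<lambda>t x y. t *\<^sub>R x + (1 - t) *\<^sub>R y) UNIV F"
    and "lsc_in euclidean F"
    and "\<nu>\<^sub>0 \<in> space (prob_algebra (state_space X 0))"
    and "proper_on (dual_space N X) Fh"
    and "convex_ext_on dual_comb (dual_space N X) Fh"
    and "lsc_in (weak_topology N X I) Fh"
    and "\<Phi> \<in> test_space N X"
    and "dual_objective h N X I B G Fh Q \<Phi> =
           (SUP \<Psi>\<in>test_space N X. dual_objective h N X I B G Fh Q \<Psi>)"
  shows "finite_measure Ph \<and> sets Ph = sets (path_space N X)
    \<and> (AE x in Q. RN_deriv Q Ph x = ennreal (exp (Delta h N B I G \<Phi> x / h)))
    \<and> (M_init X \<nu>\<^sub>0 (measure (marginal X Ph 0)) \<noteq> \<infinity> \<and>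
       (\<forall>k<N. C k (restrict (price G Ph k) (I k)) \<noteq> \<infinity>) \<longrightarrow>
         is_arg_min (primal_objective h X B G Fh Q) (\<lambda>P. P \<in> space (prob_algebra (path_space N X))) Ph
       \<and> (\<forall>P. is_arg_min (primal_objective h X B G Fh Q)
                (\<lambda>P. P \<in> space (prob_algebra (path_space N X))) P \<longrightarrow> P = Ph))"
proof -
  interpret path_model h N X B I G
    by unfold_locales (use assms in auto)
  have finQ: "finite_measure Q"
    unfolding Q_def by (rule finite_measure_ref_measure) (use assms in auto)
  have setsQ: "sets Q = sets (path_space N X)"
    unfolding Q_def by (rule sets_ref_measure)
  interpret Q: finite_measure Q by (rule finQ)
  note \<Phi> = \<open>\<Phi> \<in> test_space N X\<close>
  have maximal: "dual_objective h N X I B G Fh Q \<Psi> \<le> dual_objective h N X I B G Fh Q \<Phi>"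
    if "\<Psi> \<in> test_space N X" for \<Psi>
    unfolding \<open>dual_objective h N X I B G Fh Q \<Phi> = _\<close> using that by (rule SUP_upper)
  note context_assms = finQ setsQ \<open>proper_on _ Fh\<close> \<open>convex_ext_on _ _ Fh\<close> \<open>lsc_in _ Fh\<close> \<Phi> maximal
  have finP: "finite_measure Ph"
    unfolding Ph_def by (rule finite_measure_induced[OF context_assms])
  have setsP: "sets Ph = sets (path_space N X)"
    by (simp add: Ph_def induced_measure_def setsQ)
  have meas: "(\<lambda>x. Delta h N B I G \<Phi> x / h) \<in> borel_measurable Q"
    using bounded_measurable_exponent[OF \<Phi>] measurable_cong_sets[OF setsQ, of "borel :: real measure" borel]
    by (auto simp: bounded_measurable_def)
  have "AE x in Q. ennreal (exp (Delta h N B I G \<Phi> x / h)) = RN_deriv Q Ph x"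
    by (rule Q.RN_deriv_unique) (use meas in \<open>auto simp: Ph_def induced_measure_def\<close>)
  then have RN: "AE x in Q. RN_deriv Q Ph x = ennreal (exp (Delta h N B I G \<Phi> x / h))"
    by (rule eventually_mono) simp
  \<comment> \<open>\<open>M_init\<close> takes only the values 0 and infinity, so finiteness means
    equality of the time-0 marginal with the initial law on every measurable set. The set
    \<open>X 0\<close> then yields the total mass.\<close>
  have prob: "prob_space Ph" if fin: "M_init X \<nu>\<^sub>0 (measure (marginal X Ph 0)) \<noteq> \<infinity>"
  proof (rule prob_spaceI)
    have \<nu>: "prob_space \<nu>\<^sub>0" "sets \<nu>\<^sub>0 = sets (state_space X 0)"
      using \<open>\<nu>\<^sub>0 \<in> _\<close> by (auto simp: space_prob_algebra)
    have X0: "X 0 \<in> sets (state_space X 0)"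
      using sets.top[of "state_space X 0"] by simp
    \<comment> \<open>The time 0 is among the indices below \<open>N\<close> because
      \<open>1 \<le> N\<close>.\<close>
    have m: "(\<lambda>x. x 0) \<in> measurable Ph (state_space X 0)"
      using coordinate_measurable_P[OF finP setsP, of 0] \<open>1 \<le> N\<close> by simp
    have "measure (marginal X Ph 0) (X 0) = measure \<nu>\<^sub>0 (X 0)"
      using fin X0 by (auto simp: M_init_def split: if_splits)
    also have "\<dots> = 1"
      using prob_space.prob_space[OF \<nu>(1)] sets_eq_imp_space_eq[OF \<nu>(2)] by simp
    finally have "measure Ph (space Ph) = 1"
      using measure_distr[OF m X0] measurable_space[OF m]
      by (simp add: marginal_def vimage_def Int_def conj_commute cong: conj_cong)
    then show "emeasure Ph (space Ph) = 1"
      by (simp add: finite_measure.emeasure_eq_measure[OF finP])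
  qed
  show ?thesis
    using finP setsP RN prob
      induced_optimal[OF context_assms]
    unfolding Ph_def by blast
qed

end
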